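(* (a) There is a constant $c>0$ such that for every $k\in\mathbb{N}$, every unsatisfiable $k$-CNF formula $F$ satisfies $e(F)\geq c\cdot 2.69^k$. (b) There is a constant $C>0$ such that for every $k\in\mathbb{N}$ there exists an unsatisfiable $k$-CNF formula $F$ with $e(F)\leq C\cdot 3.51^k$.
   Context: A literal is a boolean variable $x$ or its negation $\bar{x}$. A clause is a finite set of literals (a disjunction) containing no variable together with its negation; a CNF formula is a finite set of clauses (their conjunction). A $k$-CNF formula is a CNF formula in which every clause contains exactly $k$ literals. Two clauses conflict if there is a variable appearing positively in one of them and negatively in the other. $e(F)$ denotes the number of unordered pairs of clauses of $F$ that conflict (the number of edges of the conflict graph of $F$). *)

theory Defs
  imports Complex_Main
begin

datatype 'v literal = Pos 'v | Neg 'v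

type_synonym 'v clause = "'v literal set"

type_synonym 'v cnf = "'v clause set"

definition is_clause :: "'v clause \<Rightarrow> bool" where
  "is_clause C \<longleftrightarrow> finite C \<and> \<not> (\<exists>x. Pos x \<in> C \<and> Neg x \<in> C)"

definition is_cnf :: "'v cnf \<Rightarrow> bool" where
  "is_cnf F \<longleftrightarrow> finite F \<and> (\<forall>C\<in>F. is_clause C)"

definition is_k_cnf :: "nat \<Rightarrow> 'v cnf \<Rightarrow> bool" where
  "is_k_cnf k F \<longleftrightarrow> is_cnf F \<and> (\<forall>C\<in>F. card C = k)"

fun lit_true :: "('v \<Rightarrow> bool) \<Rightarrow> 'v literal \<Rightarrow> bool" where
  "lit_true \<alpha> (Pos x) \<longleftrightarrow> \<alpha> x"
| "lit_true \<alpha> (Neg x) \<longleftrightarrow> \<not> \<alpha> x"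

definition satisfies :: "('v \<Rightarrow> bool) \<Rightarrow> 'v cnf \<Rightarrow> bool" where
  "satisfies \<alpha> F \<longleftrightarrow> (\<forall>C\<in>F. \<exists>l\<in>C. lit_true \<alpha> l)"

definition satisfiable :: "'v cnf \<Rightarrow> bool" where
  "satisfiable F \<longleftrightarrow> (\<exists>\<alpha>. satisfies \<alpha> F)"

definition conflict :: "'v clause \<Rightarrow> 'v clause \<Rightarrow> bool" where
  "conflict C D \<longleftrightarrow> (\<exists>x. (Pos x \<in> C \<and> Neg x \<in> D) \<or> (Neg x \<in> C \<and> Pos x \<in> D))"

definition conflict_edges :: "'v cnf \<Rightarrow> 'v clause set set" where
  "conflict_edges F = {{C, D} | C D. C \<in> F \<and> D \<in> F \<and> C \<noteq> D \<and> conflict C D}"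

definition num_conflicts :: "'v cnf \<Rightarrow> nat" where
  "num_conflicts F = card (conflict_edges F)"

end

theory Submission
  imports Defs "HOL-Analysis.Harmonic_Numbers" "HOL-Library.Nat_Bijection"
begin

text \<open>Lower bound: suppose \<open>F\<close> has fewer than \<open>eta ^ k / (128 k\<^sup>3)\<close> conflicts. Set each variable
  independently, favouring its more frequent literal, the more so the more often it occurs. Clauses
  containing a literal that fails with probability above \<open>1/2\<close> are so few, relative to their
  failure probability, that their total failure probability is at most \<open>1 / (8 k)\<close>. Every other
  clause \<open>D\<close> can be truncated to a nonempty \<open>D'\<close> whose failure probability is at most
  \<open>1 / (8 k d(u))\<close> for all \<open>u \<in> D'\<close>, where \<open>d(u)\<close> counts the occurrences of \<open>u\<close>: otherwise
  a potential function would grow by \<open>1 / k\<close> with each of the \<open>k\<close> literals, although it stays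
  below \<open>1\<close>. The lopsided local lemma then satisfies the truncated formula, hence \<open>F\<close>.

  Upper bound: take few positive \<open>k\<close>-clauses that refute all assignments with at most
  \<open>0.37 n\<close> true variables, and few negative \<open>k/3\<close>-clauses that refute all others. Extend each
  of the latter to \<open>k\<close>-clauses by all sign patterns on its own set of fresh variables.\<close>

section \<open>The lopsided local lemma for CNF formulas\<close>

fun lit_var :: "'v literal \<Rightarrow> 'v" where
  "lit_var (Pos x) = x"
| "lit_var (Neg x) = x"

fun compl_lit :: "'v literal \<Rightarrow> 'v literal" where
  "compl_lit (Pos x) = Neg x"
| "compl_lit (Neg x) = Pos x"

fun set_lit :: "'v literal \<Rightarrow> 'v set \<Rightarrow> 'v set" where
  "set_lit (Pos x) S = insert x S"
| "set_lit (Neg x) S = S - {x}"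

fun lit_fail :: "('v \<Rightarrow> real) \<Rightarrow> 'v literal \<Rightarrow> real" where
  "lit_fail p (Pos x) = 1 - p x"
| "lit_fail p (Neg x) = p x"

definition clause_fail :: "('v \<Rightarrow> real) \<Rightarrow> 'v clause \<Rightarrow> real" where
  "clause_fail p C = (\<Prod>l\<in>C. lit_fail p l)"

definition falsifies :: "'v set \<Rightarrow> 'v clause \<Rightarrow> bool" where
  "falsifies S C \<longleftrightarrow> (\<forall>l\<in>C. \<not> lit_true (\<lambda>x. x \<in> S) l)"

definition asg_weight :: "('v \<Rightarrow> real) \<Rightarrow> 'v set \<Rightarrow> 'v set \<Rightarrow> real" where
  "asg_weight p V S = (\<Prod>x\<in>V. if x \<in> S then p x else 1 - p x)"

text \<open>Probability under the product measure that makes \<open>x\<close> true with probability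
  \<open>p x\<close>. An assignment is its set of true variables, so finite sums over
  \<open>Pow V\<close> replace measure theory.\<close>

definition asg_prob :: "('v \<Rightarrow> real) \<Rightarrow> 'v set \<Rightarrow> ('v set \<Rightarrow> bool) \<Rightarrow> real" where
  "asg_prob p V P = (\<Sum>S\<in>Pow V. if P S then asg_weight p V S else 0)"

lemma conflict_iff: "conflict C D \<longleftrightarrow> (\<exists>l\<in>C. compl_lit l \<in> D)"
proof
  assume "conflict C D"
  then show "\<exists>l\<in>C. compl_lit l \<in> D"
    unfolding conflict_def by (metis compl_lit.simps)
next
  assume "\<exists>l\<in>C. compl_lit l \<in> D"
  then obtain l where "l \<in> C" "compl_lit l \<in> D" by blast
  then show "conflict C D" unfolding conflict_def by (cases l) auto
qed

lemma is_clause_iff: "is_clause C \<longleftrightarrow> finite C \<and> (\<forall>l\<in>C. compl_lit l \<notin> C)"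
proof -
  have "(\<exists>x. Pos x \<in> C \<and> Neg x \<in> C) \<longleftrightarrow> (\<exists>l\<in>C. compl_lit l \<in> C)"
    by (metis compl_lit.elims compl_lit.simps)
  then show ?thesis unfolding is_clause_def by blast
qed

section \<open>Product measures on assignments\<close>

lemma asg_prob_insert:
  assumes "finite V" "x \<notin> V"
  shows "asg_prob p (insert x V) P
    = p x * asg_prob p V (\<lambda>S. P (insert x S)) + (1 - p x) * asg_prob p V P"
proof -
  have inj: "inj_on (insert x) (Pow V)"
    using assms(2) by (auto simp: inj_on_def)
  have disj: "Pow V \<inter> insert x ` Pow V = {}"
    using assms(2) by auto
  have w1: "asg_weight p (insert x V) S = (1 - p x) * asg_weight p V S" if "S \<in> Pow V" for S
    using assms that unfolding asg_weight_def by auto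
  have w2: "asg_weight p (insert x V) (insert x S) = p x * asg_weight p V S" if "S \<in> Pow V" for S
  proof -
    have "(\<Prod>y\<in>V. if y \<in> insert x S then p y else 1 - p y) = (\<Prod>y\<in>V. if y \<in> S then p y else 1 - p y)"
      by (rule prod.cong) (use assms in auto)
    then show ?thesis using assms unfolding asg_weight_def by simp
  qed
  have "asg_prob p (insert x V) P
      = (\<Sum>S\<in>Pow V. if P S then asg_weight p (insert x V) S else 0)
        + (\<Sum>S\<in>Pow V. if P (insert x S) then asg_weight p (insert x V) (insert x S) else 0)"
    unfolding asg_prob_def Pow_insert
    using assms(1) disj inj by (subst sum.union_disjoint) (auto simp: sum.reindex)
  also have "\<dots> = (1 - p x) * asg_prob p V P + p x * asg_prob p V (\<lambda>S. P (insert x S))"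
    unfolding asg_prob_def sum_distrib_left
    by (intro arg_cong2[where f = "(+)"] sum.cong) (auto simp: w1 w2)
  finally show ?thesis by simp
qed

lemma asg_prob_mono:
  assumes "\<And>x. 0 \<le> p x" "\<And>x. p x \<le> 1" "\<And>S. S \<subseteq> V \<Longrightarrow> P S \<Longrightarrow> Q S"
  shows "asg_prob p V P \<le> asg_prob p V Q"
  unfolding asg_prob_def asg_weight_def
  by (intro sum_mono) (use assms in \<open>auto intro!: prod_nonneg\<close>)

lemma asg_prob_nonneg:
  assumes "\<And>x. 0 \<le> p x" "\<And>x. p x \<le> 1"
  shows "0 \<le> asg_prob p V P"
  unfolding asg_prob_def asg_weight_def
  by (intro sum_nonneg) (use assms in \<open>auto intro!: prod_nonneg\<close>)

lemma asg_prob_True: "finite V \<Longrightarrow> asg_prob p V (\<lambda>S. True) = 1"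
proof (induction V rule: finite_induct)
  case empty
  then show ?case by (simp add: asg_prob_def asg_weight_def)
next
  case (insert x V)
  then show ?case by (simp add: asg_prob_insert)
qed

lemma asg_prob_split:
  "asg_prob p V P = asg_prob p V (\<lambda>S. P S \<and> Q S) + asg_prob p V (\<lambda>S. P S \<and> \<not> Q S)"
  unfolding asg_prob_def by (subst sum.distrib[symmetric]) (rule sum.cong, auto)

lemma asg_prob_union_bound:
  assumes "\<And>x. 0 \<le> p x" "\<And>x. p x \<le> 1" "finite I"
  shows "asg_prob p V (\<lambda>S. \<exists>i\<in>I. P i S) \<le> (\<Sum>i\<in>I. asg_prob p V (P i))"
  using assms(3)
proof (induction I rule: finite_induct)
  case empty
  then show ?case by (simp add: asg_prob_def)
next
  case (insert i I)
  have "asg_prob p V (\<lambda>S. \<exists>j\<in>insert i I. P j S)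
    = asg_prob p V (\<lambda>S. (\<exists>j\<in>insert i I. P j S) \<and> P i S)
      + asg_prob p V (\<lambda>S. (\<exists>j\<in>insert i I. P j S) \<and> \<not> P i S)"
    by (rule asg_prob_split)
  also have "\<dots> \<le> asg_prob p V (P i) + asg_prob p V (\<lambda>S. \<exists>j\<in>I. P j S)"
    by (intro add_mono asg_prob_mono assms) auto
  also have "\<dots> \<le> asg_prob p V (P i) + (\<Sum>j\<in>I. asg_prob p V (P j))"
    using insert.IH by simp
  finally show ?case using insert.hyps by simp
qed

lemma lit_fail_nonneg:
  assumes "\<And>x. 0 \<le> p x" "\<And>x. p x \<le> 1"
  shows "0 \<le> lit_fail p l"
  using assms by (cases l) auto

text \<open>One-variable correlation inequality: with the other variables fixed, an event preserved
  by making \<open>l\<close> true is at least as likely when \<open>l\<close> is true as when it is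
  false.\<close>

lemma asg_prob_lit_le:
  assumes p: "\<And>x. 0 \<le> p x" "\<And>x. p x \<le> 1"
    and V: "finite V" "lit_var l \<in> V"
    and up: "\<And>S. P S \<Longrightarrow> P (set_lit l S)"
  shows "asg_prob p V (\<lambda>S. \<not> lit_true (\<lambda>x. x \<in> S) l \<and> P S) \<le> lit_fail p l * asg_prob p V P"
proof -
  define x where "x = lit_var l"
  define U where "U = V - {x}"
  have U: "finite U" "x \<notin> U" "V = insert x U"
    using V by (auto simp: U_def x_def)
  let ?a = "asg_prob p U (\<lambda>S. P (insert x S))" and ?b = "asg_prob p U P"
  have V_eq: "asg_prob p V P = p x * ?a + (1 - p x) * ?b"
    using U asg_prob_insert by metis
  show ?thesis
  proof (cases l)
    case (Pos y)
    then have [simp]: "l = Pos x" by (simp add: x_def)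
    have "asg_prob p V (\<lambda>S. \<not> lit_true (\<lambda>x. x \<in> S) l \<and> P S)
        = (1 - p x) * asg_prob p U (\<lambda>S. x \<notin> S \<and> P S)"
      unfolding U(3) using U by (simp add: asg_prob_insert) (simp add: asg_prob_def)
    also have "\<dots> \<le> (1 - p x) * ?b"
      by (intro mult_left_mono asg_prob_mono) (use p in auto)
    also have "?b \<le> ?a"
      by (intro asg_prob_mono p) (use up in auto)
    then have "(1 - p x) * ?b \<le> (1 - p x) * (p x * ?a + (1 - p x) * ?b)"
      using p[of x] by (intro mult_left_mono) (auto simp: algebra_simps mult_left_mono)
    finally show ?thesis using V_eq by simp
  next
    case (Neg y)
    then have [simp]: "l = Neg x" by (simp add: x_def)
    have up': "P S \<Longrightarrow> P (S - {x})" for S using up by simp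
    have z: "asg_prob p U (\<lambda>S. x \<in> S \<and> P S) = 0"
      unfolding asg_prob_def by (rule sum.neutral) (use U in auto)
    have "asg_prob p V (\<lambda>S. \<not> lit_true (\<lambda>x. x \<in> S) l \<and> P S) = p x * ?a"
      unfolding U(3) using U z by (simp add: asg_prob_insert)
    also have ab: "?a \<le> ?b"
    proof (intro asg_prob_mono p)
      fix S assume "S \<subseteq> U" "P (insert x S)"
      moreover from this have "insert x S - {x} = S" using U(2) by auto
      ultimately show "P S" using up'[of "insert x S"] by simp
    qed
    have "(1 - p x) * ?a \<le> (1 - p x) * ?b"
      using ab p by (intro mult_left_mono) auto
    then have "p x * ?a \<le> p x * (p x * ?a + (1 - p x) * ?b)"
      using p[of x] by (intro mult_left_mono) (auto simp: algebra_simps)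
    finally show ?thesis using V_eq by simp
  qed
qed

text \<open>Literals are peeled off one at a time. Adding the falsity of the remaining literals to
  the event keeps it closed under \<open>set_lit l\<close>, since a clause mentions the variable of
  \<open>l\<close> only once.\<close>

lemma asg_prob_clause_le:
  assumes p: "\<And>x. 0 \<le> p x" "\<And>x. p x \<le> 1"
    and V: "finite V"
    and C: "is_clause C" "lit_var ` C \<subseteq> V"
    and up: "\<And>l S. l \<in> C \<Longrightarrow> P S \<Longrightarrow> P (set_lit l S)"
  shows "asg_prob p V (\<lambda>S. falsifies S C \<and> P S) \<le> clause_fail p C * asg_prob p V P"
proof -
  have "finite C" using C by (simp add: is_clause_def)
  then show ?thesis using C up
  proof (induction C rule: finite_induct)
    case empty
    then show ?case by (simp add: falsifies_def clause_fail_def)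
  next
    case (insert l C)
    have cl: "is_clause C"
      using insert.prems(1) by (auto simp: is_clause_iff)
    let ?Q = "\<lambda>S. falsifies S C \<and> P S"
    have "asg_prob p V (\<lambda>S. falsifies S (insert l C) \<and> P S)
        = asg_prob p V (\<lambda>S. \<not> lit_true (\<lambda>x. x \<in> S) l \<and> ?Q S)"
      by (simp add: falsifies_def conj_assoc)
    also have "\<dots> \<le> lit_fail p l * asg_prob p V ?Q"
    proof (rule asg_prob_lit_le[OF p V])
      show "lit_var l \<in> V" using insert.prems by simp
      fix S assume S: "falsifies S C \<and> P S"
      have "\<not> lit_true (\<lambda>x. x \<in> set_lit l S) l'" if "l' \<in> C" for l'
      proof -
        have "\<not> lit_true (\<lambda>x. x \<in> S) l'" "l' \<noteq> l" "l' \<noteq> compl_lit l"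
          using that S insert.hyps insert.prems(1) by (auto simp: falsifies_def is_clause_iff)
        then show ?thesis by (cases l; cases l') auto
      qed
      then show "falsifies (set_lit l S) C \<and> P (set_lit l S)"
        using S insert.prems(3) by (auto simp: falsifies_def)
    qed
    also have "\<dots> \<le> lit_fail p l * (clause_fail p C * asg_prob p V P)"
      using insert.IH[OF cl] insert.prems
      by (intro mult_left_mono lit_fail_nonneg p) auto
    finally show ?case using insert.hyps by (simp add: clause_fail_def mult.assoc)
  qed
qed

lemma satisfies_set_lit:
  assumes "satisfies (\<lambda>x. x \<in> S) G" "\<And>D. D \<in> G \<Longrightarrow> compl_lit l \<notin> D"
  shows "satisfies (\<lambda>x. x \<in> set_lit l S) G"
  unfolding satisfies_def
proof
  fix D assume D: "D \<in> G"
  then obtain m where m: "m \<in> D" "lit_true (\<lambda>x. x \<in> S) m"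
    using assms(1) by (auto simp: satisfies_def)
  then have "m \<noteq> compl_lit l" using assms(2) D by auto
  then have "lit_true (\<lambda>x. x \<in> set_lit l S) m" using m by (cases l; cases m) auto
  then show "\<exists>l'\<in>D. lit_true (\<lambda>x. x \<in> set_lit l S) l'" using m by blast
qed

text \<open>A bound on a conditional probability, multiplied out so that the condition need not yet
  have positive probability. Only clauses conflicting with \<open>C\<close> do harm: making literals
  of \<open>C\<close> true cannot violate the others.\<close>

lemma lopsided_local_lemma_step:
  assumes p: "\<And>x. 0 \<le> p x" "\<And>x. p x \<le> 1"
    and F: "is_cnf F" and V: "finite V" "\<And>C. C \<in> F \<Longrightarrow> lit_var ` C \<subseteq> V"
    and nb: "\<And>C. C \<in> F \<Longrightarrow> (\<Sum>D | D \<in> F \<and> conflict C D. clause_fail p D) \<le> 1/4"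
    and "G \<subseteq> F" "C \<in> F"
  shows "asg_prob p V (\<lambda>S. falsifies S C \<and> satisfies (\<lambda>x. x \<in> S) G)
    \<le> 2 * clause_fail p C * asg_prob p V (\<lambda>S. satisfies (\<lambda>x. x \<in> S) G)"
proof -
  have finF: "finite F" using F by (simp add: is_cnf_def)
  have cf: "0 \<le> clause_fail p D" for D
    unfolding clause_fail_def by (intro prod_nonneg lit_fail_nonneg p)
  have "finite G" using assms(7) finF finite_subset by blast
  then show ?thesis using assms(7,8)
  proof (induction G arbitrary: C rule: finite_psubset_induct)
    case (psubset G)
    define G1 where "G1 = {D\<in>G. conflict C D}"
    define G2 where "G2 = G - G1"
    let ?W = "\<lambda>H. asg_prob p V (\<lambda>S. satisfies (\<lambda>x. x \<in> S) H)"
    have "asg_prob p V (\<lambda>S. falsifies S C \<and> satisfies (\<lambda>x. x \<in> S) G)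
      \<le> asg_prob p V (\<lambda>S. falsifies S C \<and> satisfies (\<lambda>x. x \<in> S) G2)"
      by (intro asg_prob_mono p) (auto simp: satisfies_def G2_def)
    also have "\<dots> \<le> clause_fail p C * ?W G2"
    proof (rule asg_prob_clause_le[OF p V(1)])
      show "is_clause C" using F psubset.prems by (simp add: is_cnf_def)
      show "lit_var ` C \<subseteq> V" using V psubset.prems by simp
      fix l S assume "l \<in> C" "satisfies (\<lambda>x. x \<in> S) G2"
      then show "satisfies (\<lambda>x. x \<in> set_lit l S) G2"
        by (intro satisfies_set_lit) (auto simp: G2_def G1_def conflict_iff)
    qed
    finally have 1: "asg_prob p V (\<lambda>S. falsifies S C \<and> satisfies (\<lambda>x. x \<in> S) G)
      \<le> clause_fail p C * ?W G2" .
    have finG1: "finite G1" using psubset.hyps by (simp add: G1_def)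
    \<comment> \<open>By induction and the union bound, the clauses of \<open>G1\<close> remove at
      most \<open>2 * 1/4\<close>, that is half, of \<open>?W G2\<close>.\<close>
    have 2: "?W G2 \<le> 2 * ?W G"
    proof (cases "G1 = {}")
      case True
      then have "G2 = G" by (simp add: G2_def)
      then show ?thesis by (simp add: asg_prob_nonneg[OF p])
    next
      case False
      then have "G2 \<subset> G" by (auto simp: G2_def G1_def)
      have IH: "asg_prob p V (\<lambda>S. falsifies S D \<and> satisfies (\<lambda>x. x \<in> S) G2)
          \<le> 2 * clause_fail p D * ?W G2" if "D \<in> G1" for D
        using psubset.IH[OF \<open>G2 \<subset> G\<close>, of D] that psubset.prems by (auto simp: G2_def G1_def)
      have "?W G2 = asg_prob p V (\<lambda>S. satisfies (\<lambda>x. x \<in> S) G2 \<and> satisfies (\<lambda>x. x \<in> S) G1)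
        + asg_prob p V (\<lambda>S. satisfies (\<lambda>x. x \<in> S) G2 \<and> \<not> satisfies (\<lambda>x. x \<in> S) G1)"
        by (rule asg_prob_split)
      also have "\<dots> \<le> ?W G + asg_prob p V
          (\<lambda>S. \<exists>D\<in>G1. falsifies S D \<and> satisfies (\<lambda>x. x \<in> S) G2)"
        by (intro add_mono asg_prob_mono p) (auto simp: satisfies_def falsifies_def G2_def)
      also have "\<dots> \<le> ?W G + (\<Sum>D\<in>G1. asg_prob p V
          (\<lambda>S. falsifies S D \<and> satisfies (\<lambda>x. x \<in> S) G2))"
        using asg_prob_union_bound[OF p finG1] by (intro add_left_mono)
      also have "\<dots> \<le> ?W G + (\<Sum>D\<in>G1. 2 * clause_fail p D * ?W G2)"
        by (intro add_left_mono sum_mono IH)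
      also have "\<dots> = ?W G + 2 * ?W G2 * (\<Sum>D\<in>G1. clause_fail p D)"
        unfolding sum_distrib_left by (simp add: mult_ac)
      also have "\<dots> \<le> ?W G + 2 * ?W G2 * (1/4)"
      proof -
        have "(\<Sum>D\<in>G1. clause_fail p D) \<le> (\<Sum>D | D \<in> F \<and> conflict C D. clause_fail p D)"
          by (rule sum_mono2) (use finF psubset.prems cf in \<open>auto simp: G1_def\<close>)
        also have "\<dots> \<le> 1/4" using nb psubset.prems by simp
        finally show ?thesis
          by (intro add_left_mono mult_left_mono) (auto simp: asg_prob_nonneg[OF p])
      qed
      finally show ?thesis by simp
    qed
    have "clause_fail p C * ?W G2 \<le> clause_fail p C * (2 * ?W G)"
      by (intro mult_left_mono 2 cf)
    with 1 show ?case by (simp add: algebra_simps)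
  qed
qed

text \<open>Each added clause \<open>C\<close> keeps at least the positive fraction
  \<open>1 - 2 * clause_fail p C\<close> of the probability, so some assignment survives all of
  \<open>F\<close>.\<close>

theorem lopsided_local_lemma:
  assumes p: "\<And>x. 0 \<le> p x" "\<And>x. p x \<le> 1"
    and F: "is_cnf F"
    and small: "\<And>C. C \<in> F \<Longrightarrow> clause_fail p C < 1/2"
    and nb: "\<And>C. C \<in> F \<Longrightarrow> (\<Sum>D | D \<in> F \<and> conflict C D. clause_fail p D) \<le> 1/4"
  shows "satisfiable F"
proof -
  define V where "V = (\<Union>C\<in>F. lit_var ` C)"
  have finF: "finite F" and V: "finite V" "\<And>C. C \<in> F \<Longrightarrow> lit_var ` C \<subseteq> V"
    using F by (auto simp: V_def is_cnf_def is_clause_def)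
  let ?W = "\<lambda>H. asg_prob p V (\<lambda>S. satisfies (\<lambda>x. x \<in> S) H)"
  have "?W G > 0" if "G \<subseteq> F" "finite G" for G
    using that(2,1)
  proof (induction G rule: finite_induct)
    case empty
    then show ?case using asg_prob_True[OF V(1)] by (simp add: satisfies_def)
  next
    case (insert C G)
    have "?W G = asg_prob p V (\<lambda>S. satisfies (\<lambda>x. x \<in> S) G \<and> falsifies S C)
        + asg_prob p V (\<lambda>S. satisfies (\<lambda>x. x \<in> S) G \<and> \<not> falsifies S C)"
      by (rule asg_prob_split)
    also have "asg_prob p V (\<lambda>S. satisfies (\<lambda>x. x \<in> S) G \<and> \<not> falsifies S C) = ?W (insert C G)"
      by (rule arg_cong[where f = "asg_prob p V"]) (auto simp: satisfies_def falsifies_def)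
    also have "asg_prob p V (\<lambda>S. satisfies (\<lambda>x. x \<in> S) G \<and> falsifies S C)
        = asg_prob p V (\<lambda>S. falsifies S C \<and> satisfies (\<lambda>x. x \<in> S) G)"
      by (simp add: conj_commute)
    also have "\<dots> \<le> 2 * clause_fail p C * ?W G"
      by (rule lopsided_local_lemma_step[OF p F V nb]) (use insert.prems in auto)
    finally have "(1 - 2 * clause_fail p C) * ?W G \<le> ?W (insert C G)"
      by (simp add: algebra_simps)
    moreover have "(1 - 2 * clause_fail p C) * ?W G > 0"
      using small[of C] insert by (intro mult_pos_pos) auto
    ultimately show ?case by linarith
  qed
  then have "?W F > 0" using finF by blast
  then have "\<exists>S. satisfies (\<lambda>x. x \<in> S) F"
    by (rule contrapos_pp) (simp add: asg_prob_def)
  then show ?thesis by (auto simp: satisfiable_def)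
qed

section \<open>The potential function\<close>

text \<open>\<open>e1_num x / e1_den x\<close> is the 15th convergent of the continued fraction
  \<open>1/(x + 1/(1 + 1/(x + 2/(1 + 2/(x + \<dots>)))))\<close> of \<open>exp x * E\<^sub>1 x\<close>, where
  \<open>E\<^sub>1 x\<close> is the integral of \<open>exp (- t) / t\<close> over \<open>t \<ge> x\<close>. Odd convergents are upper bounds.\<close>

definition e1_num :: "real \<Rightarrow> real" where
  "e1_num x = 5040 + 69264 * x + 100008 * x^2 + 49080 * x^3 + 10690 * x^4 + 1122 * x^5
     + 55 * x^6 + x^7"

definition e1_den :: "real \<Rightarrow> real" where
  "e1_den x = 40320 * x + 141120 * x^2 + 141120 * x^3 + 58800 * x^4 + 11760 * x^5
     + 1176 * x^6 + 56 * x^7 + x^8"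

definition e1_bound :: "real \<Rightarrow> real" where
  "e1_bound x = exp (- x) * (e1_num x / e1_den x)"

lemma e1_num_pos: "x > 0 \<Longrightarrow> e1_num x > 0"
  unfolding e1_num_def by (intro add_pos_pos mult_pos_pos) auto

lemma e1_den_pos: "x > 0 \<Longrightarrow> e1_den x > 0"
  unfolding e1_den_def by (intro add_pos_pos mult_pos_pos) auto

text \<open>The right-hand side is the derivative of \<open>E\<^sub>1\<close>. Comparing derivatives
  suffices later, so the integral itself is never formed.\<close>

lemma e1_bound_deriv:
  assumes "x > 0"
  shows "\<exists>D. (e1_bound has_real_derivative D) (at x) \<and> D \<le> - (exp (- x) / x)"
proof -
  define n' where "n' = 69264 + 200016 * x + 147240 * x^2 + 42760 * x^3 + 5610 * x^4 + 330 * x^5 + 7 * x^6"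
  define d' where "d' = 40320 + 282240 * x + 423360 * x^2 + 235200 * x^3 + 58800 * x^4 + 7056 * x^5 + 392 * x^6 + 8 * x^7"
  have N: "(e1_num has_real_derivative n') (at x)"
    unfolding e1_num_def n'_def by (auto intro!: derivative_eq_intros)
  have D: "(e1_den has_real_derivative d') (at x)"
    unfolding e1_den_def d'_def by (auto intro!: derivative_eq_intros)
  let ?D = "exp (- x) * ((n' * e1_den x - e1_num x * d') / (e1_den x * e1_den x))
     - exp (- x) * (e1_num x / e1_den x)"
  have pos: "e1_den x > 0" using assms by (rule e1_den_pos)
  have "(e1_bound has_real_derivative ?D) (at x)"
    unfolding e1_bound_def using pos by (auto intro!: derivative_eq_intros N D simp: field_simps)
  moreover have "?D \<le> - (exp (- x) / x)"
  proof -
    \<comment> \<open>The excess \<open>203212800 * x\<close> equals 7! * 8! * \<open>x\<close>; its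
      positivity yields the inequality.\<close>
    have id: "x * (e1_num x * e1_den x - n' * e1_den x + e1_num x * d')
        = e1_den x * e1_den x + 203212800 * x"
      unfolding e1_num_def e1_den_def n'_def d'_def by algebra
    have "1 / x \<le> (e1_num x * e1_den x - n' * e1_den x + e1_num x * d') / (e1_den x * e1_den x)"
      using pos assms id by (simp add: pos_le_divide_eq pos_divide_le_eq mult.commute[of _ x])
    also have "\<dots> = e1_num x / e1_den x - (n' * e1_den x - e1_num x * d') / (e1_den x * e1_den x)"
      using pos by (simp add: field_simps)
    finally have "exp (- x) * (1 / x) \<le> exp (- x) * (e1_num x / e1_den x - (n' * e1_den x - e1_num x * d') / (e1_den x * e1_den x))"
      by (intro mult_left_mono) auto
    then show ?thesis by (simp add: algebra_simps)
  qed
  ultimately show ?thesis by blast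
qed

text \<open>An upper bound for the integral of \<open>1 / (t * (exp t - 1))\<close> over \<open>t \<ge> s\<close>, \<open>s \<ge> ln 2\<close>, obtained
  from \<open>1 / (exp t - 1) = exp (- t) + exp (- 2 t) + \<dots>\<close>, with the terms from the tenth on estimated
  by \<open>2 * exp (- 10 t)\<close>.\<close>

definition tail_bound :: "real \<Rightarrow> real" where
  "tail_bound s = (\<Sum>n=1..9. e1_bound (real n * s)) + 2 * e1_bound (10 * s)"

lemma tail_bound_nonneg: "s > 0 \<Longrightarrow> tail_bound s \<ge> 0"
  unfolding tail_bound_def e1_bound_def
  by (intro add_nonneg_nonneg sum_nonneg mult_nonneg_nonneg divide_nonneg_nonneg)
     (auto intro!: less_imp_le[OF e1_num_pos] less_imp_le[OF e1_den_pos])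

text \<open>Termwise from \<open>e1_bound_deriv\<close>; the resulting sum is a truncated geometric
  series in \<open>y = exp (- s)\<close>.\<close>

lemma tail_bound_deriv:
  assumes "s \<ge> ln 2"
  shows "\<exists>D. (tail_bound has_real_derivative D) (at s) \<and> D \<le> - 1 / (s * (exp s - 1))"
proof -
  have s: "s > 0" using assms by (smt (verit) ln_gt_zero)
  have "\<exists>D. ((\<lambda>s. e1_bound (c * s)) has_real_derivative D) (at s) \<and> D \<le> - (exp (- c * s) / s)"
    if c: "c > 0" for c
  proof -
    obtain D where D: "(e1_bound has_real_derivative D) (at (c * s))" "D \<le> - (exp (- (c * s)) / (c * s))"
      using e1_bound_deriv[of "c * s"] c s by auto
    have "((\<lambda>s. e1_bound (c * s)) has_real_derivative D * c) (at s)"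
      by (rule DERIV_chain2[where f = e1_bound and g = "(*) c", OF D(1)]) (auto intro!: derivative_eq_intros)
    moreover have "D * c \<le> - (exp (- (c * s)) / (c * s)) * c"
      using D(2) c by (intro mult_right_mono) auto
    ultimately show ?thesis using c by (intro exI[of _ "D * c"]) auto
  qed
  then obtain D where D: "\<And>c. c > 0 \<Longrightarrow> ((\<lambda>s. e1_bound (c * s)) has_real_derivative D c) (at s)"
      "\<And>c. c > 0 \<Longrightarrow> D c \<le> - (exp (- c * s) / s)"
    by metis
  have "(tail_bound has_real_derivative (\<Sum>n=1..9. D (real n)) + 2 * D 10) (at s)"
    unfolding tail_bound_def
    by (intro DERIV_add DERIV_sum DERIV_cmult D) auto
  moreover have "(\<Sum>n=1..9. D (real n)) + 2 * D 10 \<le> - 1 / (s * (exp s - 1))"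
  proof -
    define y where "y = exp (- s)"
    have y: "0 < y" "y \<le> 1/2"
    proof -
      have "exp (- s) \<le> exp (- ln 2)" using assms by simp
      then show "y \<le> 1/2" by (simp add: y_def exp_minus)
    qed (simp add: y_def)
    have ey: "exp (- real n * s) = y ^ n" for n
      by (simp add: y_def exp_of_nat_mult[symmetric])
    have "(\<Sum>n=1..9. D (real n)) + 2 * D 10 \<le> (\<Sum>n=1..9. - (y ^ n / s)) + 2 * (- (y ^ 10 / s))"
    proof (intro add_mono sum_mono mult_left_mono)
      show "D (real n) \<le> - (y ^ n / s)" if "n \<in> {1..9}" for n
        using D(2)[of "real n"] ey[of n] that by simp
      show "D 10 \<le> - (y ^ 10 / s)" using D(2)[of 10] ey[of 10] by simp
    qed simp
    also have "\<dots> = - (((\<Sum>n=1..9. y ^ n) + 2 * y ^ 10) / s)"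
      by (simp add: sum_negf sum_divide_distrib[symmetric] add_divide_distrib)
    also have "\<dots> \<le> - ((1 / (exp s - 1)) / s)"
    proof -
      have e: "exp s = 1 / y" by (simp add: y_def exp_minus divide_inverse)
      have "1 / (exp s - 1) = y / (1 - y)" unfolding e using y by (simp add: field_simps)
      also have "\<dots> \<le> (\<Sum>n=1..9. y ^ n) + 2 * y ^ 10"
      proof -
        have "(\<Sum>n=1..9. y ^ n) * (1 - y) = y - y ^ 10"
          by (simp add: numeral_eq_Suc algebra_simps)
        \<comment> \<open>The assumption \<open>s \<ge> ln 2\<close> enters here:
          \<open>y \<le> 1/2\<close> bounds the geometric tail \<open>y ^ 10 / (1 - y)\<close> by
          \<open>2 * y ^ 10\<close>.\<close>
        moreover have "y ^ 10 \<le> 2 * y ^ 10 * (1 - y)"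
          using y mult_left_mono[of "1" "2 * (1 - y)" "y^10"] by (simp add: algebra_simps)
        ultimately have "y \<le> ((\<Sum>n=1..9. y ^ n) + 2 * y ^ 10) * (1 - y)"
          by (simp add: algebra_simps)
        then show ?thesis using y by (simp add: divide_le_eq)
      qed
      finally show ?thesis using s by (intro le_imp_neg_le divide_right_mono) auto
    qed
    finally show ?thesis by (simp add: divide_divide_eq_left mult.commute)
  qed
  ultimately show ?thesis by blast
qed

section \<open>Numerical estimates at ln 2\<close>

lemma ln2_bounds: "ln 2 \<ge> (693147/1000000 :: real)" "ln 2 \<le> (693148/1000000 :: real)"
  using ln_approx_bounds[of 2 6] by (simp_all add: eval_nat_numeral)

text \<open>At multiples of \<open>ln 2\<close> the exponential is an exact power of 2, so only the
  rational function is rounded: \<open>ln 2\<close> up in the numerator, down in the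
  denominator.\<close>

lemma e1_bound_ln2:
  assumes "n > 0"
  shows "e1_bound (real n * ln 2) \<le> e1_num (real n * (693148/1000000)) / e1_den (real n * (693147/1000000)) / 2 ^ n"
proof -
  have "e1_num (real n * ln 2) \<le> e1_num (real n * (693148/1000000))"
    unfolding e1_num_def using ln2_bounds by (intro add_mono mult_left_mono power_mono) auto
  moreover have "e1_den (real n * (693147/1000000)) \<le> e1_den (real n * ln 2)"
    unfolding e1_den_def using ln2_bounds by (intro add_mono mult_left_mono power_mono) auto
  moreover have "exp (- (real n * ln 2)) = 1 / 2 ^ n"
    by (simp add: exp_minus exp_of_nat_mult divide_inverse power_inverse)
  ultimately show ?thesis unfolding e1_bound_def using assms
    by (auto intro!: frac_le mult_right_mono mult_pos_pos less_imp_le[OF e1_num_pos] e1_den_pos)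
qed

text \<open>\<open>103/180\<close> is exactly what the bound \<open>77/180\<close> of
  \<open>ln_half_eta\<close> leaves of 1.\<close>

lemma tail_bound_ln2: "tail_bound (ln 2) \<le> 103/180"
proof -
  have b1: "e1_bound (ln 2) \<le> 379252/1000000"
    using e1_bound_ln2[of 1] by (simp add: e1_num_def e1_den_def power_divide)
  have b2: "e1_bound (2 * ln 2) \<le> 118673/1000000"
    using e1_bound_ln2[of 2] by (simp add: e1_num_def e1_den_def power_divide)
  have b3: "e1_bound (3 * ln 2) \<le> 43833/1000000"
    using e1_bound_ln2[of 3] by (simp add: e1_num_def e1_den_def power_divide)
  have b4: "e1_bound (4 * ln 2) \<le> 17462/1000000"
    using e1_bound_ln2[of 4] by (simp add: e1_num_def e1_den_def power_divide)
  have b5: "e1_bound (5 * ln 2) \<le> 7273/1000000"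
    using e1_bound_ln2[of 5] by (simp add: e1_num_def e1_den_def power_divide)
  have b6: "e1_bound (6 * ln 2) \<le> 3120/1000000"
    using e1_bound_ln2[of 6] by (simp add: e1_num_def e1_den_def power_divide)
  have b7: "e1_bound (7 * ln 2) \<le> 1367/1000000"
    using e1_bound_ln2[of 7] by (simp add: e1_num_def e1_den_def power_divide)
  have b8: "e1_bound (8 * ln 2) \<le> 609/1000000"
    using e1_bound_ln2[of 8] by (simp add: e1_num_def e1_den_def power_divide)
  have b9: "e1_bound (9 * ln 2) \<le> 275/1000000"
    using e1_bound_ln2[of 9] by (simp add: e1_num_def e1_den_def power_divide)
  have b10: "e1_bound (10 * ln 2) \<le> 125/1000000"
    using e1_bound_ln2[of 10] by (simp add: e1_num_def e1_den_def power_divide)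
  have "{1..9::nat} = {1,2,3,4,5,6,7,8,9}" by auto
  then show ?thesis unfolding tail_bound_def
    using b1 b2 b3 b4 b5 b6 b7 b8 b9 b10 by simp
qed

text \<open>Slightly above \<open>2.69\<close> to absorb polynomial factors, and below the limit \<open>2.6916\<dots>\<close>
  of the potential argument.\<close>

definition eta :: real where
  "eta = 13451/5000"

text \<open>For \<open>t < ln eta\<close> this is \<open>- ln (fail_rate (exp t))\<close>: the
  negative log of the failure probability that a favoured literal of level \<open>exp t\<close>
  contributes to its clause.\<close>

definition cost :: "real \<Rightarrow> real" where
  "cost t = - ln (min (1/2) (1 - exp t / eta))"

text \<open>The derivative of \<open>potential\<close> is at least \<open>1 / cost\<close>; above \<open>ln (eta/2)\<close>, substituting
  \<open>s = cost t\<close> turns \<open>dt / cost t\<close> into \<open>ds / (s * (exp s - 1))\<close>.\<close>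

definition potential :: "real \<Rightarrow> real" where
  "potential t = (if t \<le> ln (eta/2) then t / ln 2
     else ln (eta/2) / ln 2 + tail_bound (ln 2) - tail_bound (cost t))"

section \<open>Growth and boundedness of the potential\<close>

lemma potential_0: "potential 0 = 0"
proof -
  have "ln (eta/2) \<ge> 0" by (simp add: eta_def)
  then show ?thesis by (simp add: potential_def)
qed

text \<open>\<open>77/180\<close> lies slightly above the binary logarithm of \<open>eta/2\<close>;
  clearing denominators leaves a comparison of rational powers.\<close>

lemma ln_half_eta: "ln (eta/2) < 77/180 * ln 2"
proof -
  have "180 * ln (eta/2) = ln ((eta/2) ^ 180)" by (simp add: ln_realpow eta_def)
  also have "\<dots> < ln (2 ^ 77)"
  proof (subst ln_less_cancel_iff)
    have "(eta/2) ^ 180 = ((eta/2) ^ 18) ^ 10" by (simp flip: power_mult)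
    also have "\<dots> \<le> (2079/10) ^ 10"
      by (intro power_mono) (simp_all add: eta_def power_divide)
    also have "\<dots> < 2 ^ 77" by (simp add: power_divide)
    finally show "(eta/2) ^ 180 < 2 ^ 77" .
  qed (simp_all add: eta_def)
  also have "\<dots> = 77 * ln 2" by (subst ln_realpow) auto
  finally show ?thesis by simp
qed

lemma cost_below: "t \<le> ln (eta/2) \<Longrightarrow> cost t = ln 2"
proof -
  assume "t \<le> ln (eta/2)"
  then have "exp t \<le> eta/2" by (simp add: eta_def ln_ge_iff)
  then show ?thesis by (simp add: cost_def eta_def min_def ln_div)
qed

lemma cost_above:
  assumes "ln (eta/2) \<le> t" "t < ln eta"
  shows "cost t = - ln (1 - exp t / eta)" "exp t < eta" "ln 2 \<le> cost t"
proof -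
  have e: "eta/2 \<le> exp t" "exp t < eta"
    using assms exp_le_cancel_iff[of "ln (eta/2)" t] exp_less_cancel_iff[of t "ln eta"]
    by (simp_all add: eta_def)
  then show "exp t < eta" by simp
  show c: "cost t = - ln (1 - exp t / eta)"
    using e by (auto simp: cost_def eta_def min_def)
  have "ln (1 - exp t / eta) \<le> ln (1/2)"
    using e by (subst ln_le_cancel_iff) (auto simp: eta_def)
  then show "ln 2 \<le> cost t" by (simp add: c ln_div)
qed

lemma cost_mono:
  assumes "s \<le> t" "t < ln eta"
  shows "cost s \<le> cost t"
proof -
  have e: "exp t < eta" "exp s \<le> exp t"
    using assms exp_less_cancel_iff[of t "ln eta"] by (simp_all add: eta_def)
  have "min (1/2) (1 - exp t / eta) \<le> min (1/2) (1 - exp s / eta)"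
    by (intro min.mono diff_left_mono divide_right_mono e) (auto simp: eta_def)
  moreover have "0 < min (1/2) (1 - exp t / eta)"
    using e(1) by (simp add: eta_def)
  ultimately have "ln (min (1/2) (1 - exp t / eta)) \<le> ln (min (1/2) (1 - exp s / eta))"
    by (intro ln_mono) auto
  then show ?thesis by (simp add: cost_def)
qed

lemma cost_pos:
  assumes "t < ln eta"
  shows "0 < cost t"
proof -
  have "ln 2 \<le> cost t"
    using cost_below[of t] cost_above(3)[OF _ assms] by (cases "t \<le> ln (eta/2)") auto
  then show ?thesis using ln2_bounds by linarith
qed

lemma potential_step_above:
  assumes "ln (eta/2) \<le> s" "s \<le> t" "t < ln eta"
  shows "(t - s) / cost t \<le> tail_bound (cost s) - tail_bound (cost t)"
proof -
  \<comment> \<open>The smooth formula stands in for \<open>cost u\<close>, whose \<open>min\<close>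
    has a kink at \<open>ln (eta/2)\<close>. The divisor is frozen at \<open>cost t\<close>, the
    largest cost on the interval.\<close>
  let ?f = "\<lambda>u. - tail_bound (- ln (1 - exp u / eta)) - u / cost t"
  have "?f s \<le> ?f t"
  proof (rule DERIV_nonneg_imp_nondecreasing[OF assms(2)])
    fix u assume u: "s \<le> u" "u \<le> t"
    then have u': "ln (eta/2) \<le> u" "u < ln eta" using assms by auto
    define w where "w = 1 - exp u / eta"
    have w: "0 < w" "cost u = - ln w" using cost_above[OF u'] by (auto simp: w_def eta_def)
    have ew: "exp (cost u) = 1 / w" using w by (simp add: exp_minus divide_inverse)
    have w1: "w < 1" by (simp add: w_def eta_def)
    obtain D where D: "(tail_bound has_real_derivative D) (at (cost u))"
        "D \<le> - 1 / (cost u * (exp (cost u) - 1))"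
      using tail_bound_deriv[OF cost_above(3)[OF u']] by blast
    have E: "((\<lambda>u. - ln (1 - exp u / eta)) has_real_derivative ((1 - w) / w)) (at u)"
      using w(1) unfolding w_def by (auto intro!: derivative_eq_intros simp: eta_def field_simps)
    have "((\<lambda>u. tail_bound (- ln (1 - exp u / eta))) has_real_derivative D * ((1 - w) / w)) (at u)"
      by (rule DERIV_chain2[where f = tail_bound, OF _ E]) (use D(1) w(2) in \<open>simp add: w_def\<close>)
    then have "(?f has_real_derivative (- (D * ((1 - w) / w)) - 1 / cost t)) (at u)"
      using cost_pos[OF assms(3)] by (auto intro!: derivative_eq_intros)
    moreover have "0 \<le> - (D * ((1 - w) / w)) - 1 / cost t"
    proof -
      have cu: "0 < cost u" by (rule cost_pos[OF u'(2)])
      have "1 / cost t \<le> 1 / cost u"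
        using cost_mono[OF u(2) assms(3)] cu by (intro divide_left_mono) auto
      \<comment> \<open>Since \<open>exp (cost u) - 1 = (1 - w) / w\<close>, the inner derivative of
        the chain rule cancels against this factor.\<close>
      also have "\<dots> = 1 / (cost u * (exp (cost u) - 1)) * ((1 - w) / w)"
        unfolding ew using w(1) w1 cu by (simp add: field_simps)
      also have "\<dots> \<le> (- D) * ((1 - w) / w)"
        using D(2) w w1 by (intro mult_right_mono) auto
      finally show ?thesis by simp
    qed
    ultimately show "\<exists>y. (?f has_real_derivative y) (at u) \<and> 0 \<le> y" by blast
  qed
  moreover have "cost s = - ln (1 - exp s / eta)" "cost t = - ln (1 - exp t / eta)"
    using cost_above(1) assms by auto
  ultimately show ?thesis by (simp add: diff_divide_distrib)
qed

text \<open>The slope is at least \<open>1 / cost\<close> on both branches and \<open>cost\<close>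
  is monotone, so the cost at the upper end serves for the whole interval. An interval crossing the
  breakpoint is split there.\<close>

lemma potential_step:
  assumes "s \<le> t" "t < ln eta"
  shows "(t - s) / cost t \<le> potential t - potential s"
proof -
  define b where "b = ln (eta/2)"
  \<comment> \<open>Valid at \<open>u = b\<close> too: there \<open>cost b = ln 2\<close> and the
    two tail terms cancel.\<close>
  have pb: "potential u = b / ln 2 + tail_bound (ln 2) - tail_bound (cost u)" if "b \<le> u" for u
    using that cost_below[of b] by (auto simp: potential_def b_def)
  have pa: "potential u = u / ln 2" "cost u = ln 2" if "u \<le> b" for u
    using that cost_below by (auto simp: potential_def b_def)
  have above: "(t - u) / cost t \<le> potential t - potential u" if "b \<le> u" "u \<le> t" for u
    using potential_step_above[of u t] that assms pb by (auto simp: b_def)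
  consider "t \<le> b" | "b \<le> s" | "s \<le> b" "b \<le> t" by linarith
  then show ?thesis
  proof cases
    case 1
    then show ?thesis using pa[of s] pa[of t] assms by (simp add: diff_divide_distrib)
  next
    case 2
    then show ?thesis using above assms by simp
  next
    case 3
    have "(b - s) / cost t \<le> (b - s) / ln 2"
      using cost_mono[OF 3(2) assms(2)] pa(2)[of b] cost_pos[OF assms(2)] 3
      by (intro divide_left_mono) auto
    also have "\<dots> = potential b - potential s"
      using pa[of s] pa[of b] 3 by (simp add: diff_divide_distrib)
    finally show ?thesis using above[of b] 3 by (simp add: diff_divide_distrib)
  qed
qed

text \<open>The two branches contribute less than \<open>77/180\<close> and at most
  \<open>103/180\<close>. This is the inequality that limits the size of \<open>eta\<close>.\<close>

lemma potential_less_1: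
  assumes "t < ln eta"
  shows "potential t < 1"
proof -
  have b: "ln (eta/2) / ln 2 < 77/180"
    using ln_half_eta ln2_bounds by (simp add: divide_less_eq)
  show ?thesis
  proof (cases "t \<le> ln (eta/2)")
    case True
    then have "t / ln 2 \<le> ln (eta/2) / ln 2" by (intro divide_right_mono) auto
    then show ?thesis using b True unfolding potential_def by (subst if_P) linarith+
  next
    case False
    then show ?thesis
      using b tail_bound_ln2 tail_bound_nonneg[OF cost_pos[OF assms]]
      unfolding potential_def by (subst if_not_P) linarith+
  qed
qed

text \<open>Failure probability of the favoured literal at level \<open>a\<close>. From level
  \<open>eta\<close> on the variable is fixed. The linear form keeps the failure probability of the
  other literal at most \<open>a / eta\<close> whenever it exceeds \<open>1/2\<close>.\<close>

definition fail_rate :: "real \<Rightarrow> real" where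
  "fail_rate a = min (1/2) (max 0 (1 - a / eta))"

text \<open>Removing the element \<open>u\<close> witnessing that \<open>S\<close> itself is bad lowers the potential by at least
  \<open>1 / k\<close>, because \<open>t < ln (A u)\<close>.\<close>

lemma potential_ge_card:
  fixes A :: "'a \<Rightarrow> real"
  assumes k: "k > 0" and "finite S" and A: "\<And>u. u \<in> S \<Longrightarrow> 0 \<le> A u"
    and bad: "\<And>S'. S' \<subseteq> S \<Longrightarrow> S' \<noteq> {} \<Longrightarrow> \<exists>u\<in>S'. A u ^ k * (\<Prod>v\<in>S'. fail_rate (A v)) > 1"
  defines "t \<equiv> - ln (\<Prod>v\<in>S. fail_rate (A v)) / real k"
  shows "(\<Prod>v\<in>S. fail_rate (A v)) > 0 \<and> t < ln eta \<and> real (card S) / real k \<le> potential t"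
  using assms(2) A bad unfolding t_def
proof (induction S rule: finite_psubset_induct)
  case (psubset S)
  show ?case
  proof (cases "S = {}")
    case True
    then show ?thesis by (simp add: potential_0 eta_def)
  next
    case False
    let ?P = "\<lambda>S. \<Prod>v\<in>S. fail_rate (A v)"
    define t where "t = - ln (?P S) / real k"
    obtain u where u: "u \<in> S" "A u ^ k * ?P S > 1"
      using psubset.prems(2)[of S] False by blast
    define S' where "S' = S - {u}"
    define s where "s = - ln (?P S') / real k"
    have S': "S' \<subset> S" using u by (auto simp: S'_def)
    have IH: "?P S' > 0" "real (card S') / real k \<le> potential s"
      using psubset.IH[OF S'] psubset.prems S' unfolding s_def by blast+
    have split: "?P S = fail_rate (A u) * ?P S'"
      using psubset.hyps u by (simp add: S'_def prod.remove)
    have P0: "?P S \<ge> 0" by (intro prod_nonneg) (auto simp: fail_rate_def)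
    have A0: "A u \<ge> 0" using psubset.prems(1) u by simp
    have P: "?P S > 0" using P0 u(2) by (cases "?P S = 0") auto
    have Au: "A u > 0" using A0 u(2) k by (cases "A u = 0") (auto simp: power_0_left)
    have f: "fail_rate (A u) > 0" using P split IH(1) by (simp add: zero_less_mult_iff)
    then have Ae: "A u < eta" and fr: "fail_rate (A u) = min (1/2) (1 - A u / eta)"
      by (auto simp: fail_rate_def eta_def split: if_splits)
    have "0 < ln (A u ^ k * ?P S)" using u(2) by simp
    also have "\<dots> = real k * ln (A u) + ln (?P S)"
      using Au P by (simp add: ln_mult ln_realpow)
    \<comment> \<open>Badness of \<open>S\<close> at \<open>u\<close> is, after taking logarithms,
      exactly this inequality.\<close>
    finally have tA: "t < ln (A u)" using k by (simp add: t_def field_simps)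
    then have te: "t < ln eta" using Ae Au by (smt (verit) ln_less_cancel_iff)
    have etA: "exp t < A u" using tA Au by (metis exp_less_mono exp_ln)
    \<comment> \<open>The level of \<open>u\<close> exceeds \<open>exp t\<close>, so
      \<open>u\<close> contributes at least \<open>cost t\<close>; dividing by \<open>cost t\<close>
      below gives the gain \<open>1 / k\<close>.\<close>
    have cst: "cost t \<le> - ln (fail_rate (A u))"
    proof -
      have "ln (fail_rate (A u)) \<le> ln (min (1/2) (1 - exp t / eta))"
        using f etA unfolding fr by (subst ln_le_cancel_iff) (auto simp: eta_def min_def)
      then show ?thesis by (simp add: cost_def)
    qed
    have ts: "t - s = - ln (fail_rate (A u)) / real k"
      unfolding t_def s_def split using f IH(1) by (simp add: ln_mult diff_divide_distrib add_divide_distrib)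
    have cp: "cost t > 0" by (rule cost_pos[OF te])
    then have "0 \<le> t - s" unfolding ts using cst k by (intro divide_nonneg_pos) auto
    have "1 / real k = (cost t / real k) / cost t" using cp by simp
    also have "\<dots> \<le> (t - s) / cost t"
      unfolding ts using cst cp k by (intro divide_right_mono) auto
    also have "\<dots> \<le> potential t - potential s"
      using potential_step[OF _ te] \<open>0 \<le> t - s\<close> by simp
    finally have "real (card S') / real k + 1 / real k \<le> potential t" using IH(2) by linarith
    moreover have "card S = Suc (card S')"
      using psubset.hyps u unfolding S'_def by (metis card.remove)
    ultimately show ?thesis using P te unfolding t_def by (simp add: add_divide_distrib)
  qed
qed

text \<open>If every nonempty subset were bad, \<open>potential_ge_card\<close> would give a
  potential of at least \<open>card D / k = 1\<close>, against
  \<open>potential_less_1\<close>.\<close>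

lemma truncation_exists:
  fixes A :: "'a \<Rightarrow> real"
  assumes "finite D" "card D = k" "k > 0" "\<And>u. u \<in> D \<Longrightarrow> 0 \<le> A u"
  shows "\<exists>D'\<subseteq>D. D' \<noteq> {} \<and> (\<forall>u\<in>D'. A u ^ k * (\<Prod>v\<in>D'. fail_rate (A v)) \<le> 1)"
proof (rule ccontr)
  assume "\<not> ?thesis"
  then have "\<And>S'. S' \<subseteq> D \<Longrightarrow> S' \<noteq> {} \<Longrightarrow> \<exists>u\<in>S'. A u ^ k * (\<Prod>v\<in>S'. fail_rate (A v)) > 1"
    by (meson not_le)
  from potential_ge_card[OF assms(3,1,4) this]
  show False using potential_less_1 assms(2,3) by fastforce
qed

section \<open>The lower bound\<close>

text \<open>Absorbs polynomial factors into a slightly worse exponential base. Writing the base as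
  \<open>y ^ m\<close> makes the expression the \<open>m\<close>-th power of the bounded sequence
  \<open>n * y ^ n\<close>.\<close>

lemma poly_times_power_bounded:
  fixes y :: real
  assumes "0 \<le> y" "y < 1"
  shows "\<exists>B>0. \<forall>n. real n ^ m * (y ^ m) ^ n \<le> B"
proof -
  have "(\<lambda>n. real n * y ^ n) \<longlonglongrightarrow> 0"
    using powser_times_n_limit_0[of y] assms by simp
  then have "Bseq (\<lambda>n. real n * y ^ n)"
    by (intro convergent_imp_Bseq convergentI)
  then obtain B where B: "B > 0" "\<And>n. norm (real n * y ^ n) \<le> B"
    unfolding Bseq_def by blast
  have "real n ^ m * (y ^ m) ^ n \<le> B ^ m" for n
  proof -
    have "real n ^ m * (y ^ m) ^ n = (real n * y ^ n) ^ m"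
      by (simp add: power_mult_distrib power_mult[symmetric] mult.commute)
    also have "\<dots> \<le> B ^ m" using B(2)[of n] assms by (intro power_mono) auto
    finally show ?thesis .
  qed
  then show ?thesis using B(1) by (intro exI[of _ "B ^ m"]) auto
qed

section \<open>Occurrence counts and the biased assignment\<close>

definition occ :: "'v cnf \<Rightarrow> 'v literal \<Rightarrow> nat" where
  "occ F l = card {C\<in>F. l \<in> C}"

definition max_occ :: "'v cnf \<Rightarrow> 'v \<Rightarrow> nat" where
  "max_occ F x = max (occ F (Pos x)) (occ F (Neg x))"

text \<open>Scaled so that the condition \<open>A u ^ k * \<dots> \<le> 1\<close> of
  \<open>truncation_exists\<close> says that failure probability times occurrences is at most
  \<open>1 / (8 k)\<close>.\<close>

definition level :: "nat \<Rightarrow> 'v cnf \<Rightarrow> 'v \<Rightarrow> real" where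
  "level k F x = root k (8 * real k * real (max_occ F x))"

definition bias :: "nat \<Rightarrow> 'v cnf \<Rightarrow> 'v \<Rightarrow> real" where
  "bias k F x = (if occ F (Neg x) \<le> occ F (Pos x) then 1 - fail_rate (level k F x)
     else fail_rate (level k F x))"

lemma fail_rate_bounds: "0 \<le> fail_rate a" "fail_rate a \<le> 1/2"
  unfolding fail_rate_def by (simp, rule min.cobounded1)

lemma bias_bounds: "0 \<le> bias k F x" "bias k F x \<le> 1"
  using fail_rate_bounds[of "level k F x"] by (auto simp: bias_def)

lemma level_nonneg: "0 \<le> level k F x"
  by (cases "k = 0") (auto simp: level_def)

lemma level_power: "k > 0 \<Longrightarrow> level k F x ^ k = 8 * real k * real (max_occ F x)"
  by (simp add: level_def)

lemma occ_le_max: "occ F l \<le> max_occ F (lit_var l)"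
  by (cases l) (auto simp: max_occ_def)

text \<open>The second case is an unfavoured literal, whose complement is therefore the more
  frequent one; an unfavoured literal with rate exactly \<open>1/2\<close> falls under the
  first.\<close>

lemma lit_fail_bias:
  "lit_fail (bias k F) l = fail_rate (level k F (lit_var l)) \<or>
   (1/2 < lit_fail (bias k F) l \<and> lit_fail (bias k F) l \<le> level k F (lit_var l) / eta
     \<and> max_occ F (lit_var l) = occ F (compl_lit l))"
proof -
  have *: "1 - fail_rate a = fail_rate a \<or> (1/2 < 1 - fail_rate a \<and> 1 - fail_rate a \<le> a / eta)"
    if "0 \<le> a" for a
    using that by (auto simp: fail_rate_def min_def max_def eta_def)
  show ?thesis
    using *[OF level_nonneg, of k F "lit_var l"] by (cases l) (auto simp: bias_def max_occ_def)
qed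

section \<open>Counting conflicts\<close>

definition conflict_pairs :: "'v cnf \<Rightarrow> ('v clause \<times> 'v clause) set" where
  "conflict_pairs F = {(C, D). C \<in> F \<and> D \<in> F \<and> conflict C D}"

lemma finite_conflict_pairs: "finite F \<Longrightarrow> finite (conflict_pairs F)"
  by (rule finite_subset[of _ "F \<times> F"]) (auto simp: conflict_pairs_def)

lemma conflict_irrefl: "is_clause C \<Longrightarrow> \<not> conflict C C"
  by (auto simp: is_clause_def conflict_def)

text \<open>An edge arises from at most its two orderings; no pair is diagonal because a clause does
  not conflict with itself.\<close>

lemma card_conflict_pairs:
  assumes "is_cnf F"
  shows "card (conflict_pairs F) \<le> 2 * num_conflicts F"
proof -
  have fin: "finite F" using assms by (simp add: is_cnf_def)
  have finE: "finite (conflict_edges F)"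
    by (rule finite_subset[of _ "Pow F"]) (use fin in \<open>auto simp: conflict_edges_def\<close>)
  have cover: "conflict_pairs F \<subseteq> (\<Union>e\<in>conflict_edges F. {(C, D). {C, D} = e})"
  proof
    fix P assume "P \<in> conflict_pairs F"
    then obtain C D where P: "P = (C, D)" "C \<in> F" "D \<in> F" "conflict C D"
      by (auto simp: conflict_pairs_def)
    then have "C \<noteq> D" using assms conflict_irrefl by (auto simp: is_cnf_def)
    with P have "{C, D} \<in> conflict_edges F" by (auto simp: conflict_edges_def)
    then show "P \<in> (\<Union>e\<in>conflict_edges F. {(C, D). {C, D} = e})" using P by blast
  qed
  have two: "card {(C, D). {C, D} = e} \<le> 2 \<and> finite {(C, D). {C, D} = e}"
    if "e \<in> conflict_edges F" for e :: "'a clause set"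
  proof -
    obtain A B where e: "e = {A, B}" using \<open>e \<in> conflict_edges F\<close> by (auto simp: conflict_edges_def)
    have s: "{(C, D). {C, D} = e} \<subseteq> {(A, B), (B, A)}" by (auto simp: e doubleton_eq_iff)
    have "card {(A, B), (B, A)} \<le> 2" using card_length[of "[(A, B), (B, A)]"] by simp
    then show ?thesis using s card_mono[OF _ s] finite_subset[OF s] by auto
  qed
  have "card (conflict_pairs F) \<le> card (\<Union>e\<in>conflict_edges F. {(C, D). {C, D} = e})"
    by (rule card_mono[OF _ cover]) (use finE two in blast)
  also have "\<dots> \<le> (\<Sum>e\<in>conflict_edges F. card {(C, D). {C, D} = e})"
    by (rule card_UN_le[OF finE])
  also have "\<dots> \<le> (\<Sum>e\<in>conflict_edges F. 2)"
    by (rule sum_mono) (use two in blast)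
  finally show ?thesis by (simp add: num_conflicts_def)
qed

text \<open>Double counting: a triple of \<open>D\<close>, \<open>l\<close> in \<open>D\<close> and
  \<open>C\<close> containing the complement of \<open>l\<close> is determined by the ordered
  conflict pair and one of the \<open>k\<close> literals of \<open>D\<close>.\<close>

lemma sum_occ_compl_le:
  assumes "is_k_cnf k F"
  shows "(\<Sum>D\<in>F. \<Sum>l\<in>D. occ F (compl_lit l)) \<le> 2 * k * num_conflicts F"
proof -
  have F: "is_cnf F" "finite F" "\<And>D. D \<in> F \<Longrightarrow> finite D" "\<And>D. D \<in> F \<Longrightarrow> card D = k"
    using assms by (auto simp: is_k_cnf_def is_cnf_def is_clause_def)
  have "(\<Sum>D\<in>F. \<Sum>l\<in>D. occ F (compl_lit l)) = card (SIGMA D:F. SIGMA l:D. {C\<in>F. compl_lit l \<in> C})"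
    using F by (simp add: occ_def)
  also have "\<dots> \<le> card (SIGMA P:conflict_pairs F. fst P)"
  proof (rule card_inj_on_le)
    show "inj_on (\<lambda>(D, l, C). ((D, C), l)) (SIGMA D:F. SIGMA l:D. {C\<in>F. compl_lit l \<in> C})"
      by (auto simp: inj_on_def)
    show "(\<lambda>(D, l, C). ((D, C), l)) ` (SIGMA D:F. SIGMA l:D. {C\<in>F. compl_lit l \<in> C})
        \<subseteq> (SIGMA P:conflict_pairs F. fst P)"
      by (auto simp: conflict_pairs_def conflict_iff)
    show "finite (SIGMA P:conflict_pairs F. fst P)"
      using finite_conflict_pairs[OF F(2)] F(3) by (intro finite_SigmaI) (auto simp: conflict_pairs_def)
  qed
  also have "\<dots> = (\<Sum>P\<in>conflict_pairs F. card (fst P))"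
    using finite_conflict_pairs[OF F(2)] F(3) by (subst card_SigmaI) (auto simp: conflict_pairs_def)
  also have "\<dots> = (\<Sum>P\<in>conflict_pairs F. k)"
    using F(4) by (intro sum.cong) (auto simp: conflict_pairs_def)
  also have "\<dots> \<le> 2 * k * num_conflicts F"
    using card_conflict_pairs[OF F(1)] by simp
  finally show ?thesis .
qed

lemma satisfiable_truncation:
  assumes "\<And>D. D \<in> F \<Longrightarrow> f D \<subseteq> D" "satisfiable (f ` F)"
  shows "satisfiable F"
  using assms unfolding satisfiable_def satisfies_def by (meson image_eqI subsetD)

text \<open>Light clauses stay whole and the rest are truncated. For every literal of a clause, each
  of the two kinds adds at most \<open>1 / (8 k)\<close> to the neighbourhood sum, which therefore
  stays within \<open>1/4\<close>.\<close>

lemma few_conflicts_satisfiable: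
  assumes k: "k > 0" and F: "is_k_cnf k F"
    and few: "128 * real k ^ 3 * real (num_conflicts F) \<le> eta ^ k"
  shows "satisfiable F"
proof -
  have cnf: "is_cnf F" "finite F" and fin: "\<And>D. D \<in> F \<Longrightarrow> finite D" and card: "\<And>D. D \<in> F \<Longrightarrow> card D = k"
    using F by (auto simp: is_k_cnf_def is_cnf_def is_clause_def)
  let ?p = "bias k F"
  let ?A = "\<lambda>l. level k F (lit_var l)"
  note lf0 = lit_fail_nonneg[of ?p, OF bias_bounds]
  define light where "light D \<longleftrightarrow> (\<exists>l\<in>D. 1/2 < lit_fail ?p l)" for D
  have eta0: "eta > 0" by (simp add: eta_def)
  have occ_ge_1: "1 \<le> occ F l" if "D \<in> F" "l \<in> D" for D l
  proof -
    have "{C\<in>F. l \<in> C} \<noteq> {}" using that by blast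
    then show ?thesis unfolding occ_def using cnf(2) by (simp add: Suc_le_eq card_gt_0_iff)
  qed
  have "\<exists>D'\<subseteq>D. D' \<noteq> {} \<and> (\<forall>l\<in>D'. clause_fail ?p D' * real (occ F l) \<le> 1 / (8 * real k))"
    if D: "D \<in> F" "\<not> light D" for D
  proof -
    have fr: "lit_fail ?p l = fail_rate (?A l)" if "l \<in> D" for l
      using D(2) that lit_fail_bias[of k F l] by (auto simp: light_def)
    have "\<exists>D'\<subseteq>D. D' \<noteq> {} \<and> (\<forall>u\<in>D'. ?A u ^ k * (\<Prod>v\<in>D'. fail_rate (?A v)) \<le> 1)"
      by (rule truncation_exists[OF fin[OF D(1)] card[OF D(1)] k]) (rule level_nonneg)
    then obtain D' where D': "D' \<subseteq> D" "D' \<noteq> {}"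
        "\<forall>u\<in>D'. ?A u ^ k * (\<Prod>v\<in>D'. fail_rate (?A v)) \<le> 1"
      by (elim exE conjE) (rule that)
    have cf: "clause_fail ?p D' = (\<Prod>v\<in>D'. fail_rate (?A v))"
      unfolding clause_fail_def using D'(1) fr by (intro prod.cong) auto
    have "clause_fail ?p D' * real (occ F l) \<le> 1 / (8 * real k)" if "l \<in> D'" for l
    proof -
      have "8 * real k * (clause_fail ?p D' * real (occ F l))
          \<le> 8 * real k * (clause_fail ?p D' * real (max_occ F (lit_var l)))"
        using occ_le_max[of F l] by (intro mult_left_mono) (auto simp: clause_fail_def intro: prod_nonneg lf0)
      also have "\<dots> = ?A l ^ k * clause_fail ?p D'" using level_power[OF k, of F] by simp
      also have "\<dots> \<le> 1" using D'(3) that cf by simp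
      finally show ?thesis using k by (simp add: field_simps)
    qed
    then show ?thesis using D' by blast
  qed
  then have "\<exists>f. \<forall>D. D \<in> F \<and> \<not> light D \<longrightarrow> f D \<subseteq> D \<and> f D \<noteq> {} \<and>
      (\<forall>l\<in>f D. clause_fail ?p (f D) * real (occ F l) \<le> 1 / (8 * real k))"
    by (intro choice) blast
  then obtain f0 where f0: "\<And>D. D \<in> F \<Longrightarrow> \<not> light D \<Longrightarrow> f0 D \<subseteq> D"
    "\<And>D. D \<in> F \<Longrightarrow> \<not> light D \<Longrightarrow> f0 D \<noteq> {}"
    "\<And>D l. D \<in> F \<Longrightarrow> \<not> light D \<Longrightarrow> l \<in> f0 D \<Longrightarrow> clause_fail ?p (f0 D) * real (occ F l) \<le> 1 / (8 * real k)"
    by blast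
  define f where "f D = (if light D then D else f0 D)" for D
  have fsub: "f D \<subseteq> D" if "D \<in> F" for D using f0(1) that by (auto simp: f_def)
  have cf0: "0 \<le> clause_fail ?p C" for C unfolding clause_fail_def by (intro prod_nonneg lf0)

  \<comment> \<open>The literal \<open>l\<close> of largest failure probability is unfavoured, so
    all \<open>k\<close> factors are at most its level over \<open>eta\<close>; the
    \<open>k\<close>-th power of the level turns into an occurrence count of the complement.\<close>
  have light_fail: "clause_fail ?p D \<le> 8 * real k / eta ^ k * (\<Sum>l\<in>D. real (occ F (compl_lit l)))"
    if D: "D \<in> F" "light D" for D
  proof -
    have "D \<noteq> {}" using D(2) by (auto simp: light_def)
    then have "Max (lit_fail ?p ` D) \<in> lit_fail ?p ` D" using fin[OF D(1)] by simp
    then obtain l where "l \<in> D" "Max (lit_fail ?p ` D) = lit_fail ?p l" by blast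
    then have l: "l \<in> D" "\<And>m. m \<in> D \<Longrightarrow> lit_fail ?p m \<le> lit_fail ?p l"
      using Max_ge[of "lit_fail ?p ` D"] fin[OF D(1)] by auto
    have "1/2 < lit_fail ?p l" using D(2) l by (force simp: light_def)
    then have h: "lit_fail ?p l \<le> ?A l / eta" "max_occ F (lit_var l) = occ F (compl_lit l)"
      using lit_fail_bias[of k F l] fail_rate_bounds(2)[of "?A l"] by auto
    have "clause_fail ?p D \<le> (\<Prod>m\<in>D. ?A l / eta)"
      unfolding clause_fail_def using lf0 l(2) h(1) by (intro prod_mono) force
    also have "\<dots> = 8 * real k / eta ^ k * real (occ F (compl_lit l))"
      using card[OF D(1)] level_power[OF k, of F "lit_var l"] h(2) by (simp add: power_divide)
    also have "\<dots> \<le> 8 * real k / eta ^ k * (\<Sum>l\<in>D. real (occ F (compl_lit l)))"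
      using eta0 l(1) fin[OF D(1)] by (intro mult_left_mono member_le_sum) auto
    finally show ?thesis .
  qed
  \<comment> \<open>The total is at most \<open>16 * k^2 / eta ^ k\<close> times the number of
    conflicts; the factor \<open>128 * k^3\<close> in the hypothesis is what brings this below
    \<open>1 / (8 k)\<close>.\<close>
  have light_sum: "(\<Sum>D | D \<in> F \<and> light D. clause_fail ?p D) \<le> 1 / (8 * real k)"
  proof -
    have "(\<Sum>D | D \<in> F \<and> light D. clause_fail ?p D)
        \<le> (\<Sum>D | D \<in> F \<and> light D. 8 * real k / eta ^ k * (\<Sum>l\<in>D. real (occ F (compl_lit l))))"
      using light_fail by (intro sum_mono) auto
    also have "\<dots> \<le> (\<Sum>D\<in>F. 8 * real k / eta ^ k * (\<Sum>l\<in>D. real (occ F (compl_lit l))))"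
      using eta0 cnf(2) by (intro sum_mono2) (auto intro!: sum_nonneg divide_nonneg_nonneg mult_nonneg_nonneg)
    also have "\<dots> = 8 * real k / eta ^ k * real (\<Sum>D\<in>F. \<Sum>l\<in>D. occ F (compl_lit l))"
      by (simp add: sum_distrib_left)
    also have "\<dots> \<le> 8 * real k / eta ^ k * real (2 * k * num_conflicts F)"
      by (intro mult_left_mono of_nat_mono sum_occ_compl_le[OF F]) (use eta0 in auto)
    also have "\<dots> \<le> 1 / (8 * real k)"
      using few k eta0 by (simp add: field_simps power3_eq_cube)
    finally show ?thesis .
  qed
  \<comment> \<open>At most \<open>occ F l\<close> truncated clauses contain \<open>l\<close>, and
    each has weight at most \<open>1 / (8 k)\<close> divided by \<open>occ F l\<close>.\<close>
  have heavy_sum: "(\<Sum>D | D \<in> F \<and> \<not> light D \<and> l \<in> f D. clause_fail ?p (f D)) \<le> 1 / (8 * real k)" for l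
  proof -
    let ?H = "{D. D \<in> F \<and> \<not> light D \<and> l \<in> f D}"
    have sub: "?H \<subseteq> {C\<in>F. l \<in> C}" using fsub by blast
    show ?thesis
    proof (cases "?H = {}")
      case True
      show ?thesis unfolding True by simp
    next
      case False
      then have o: "1 \<le> occ F l" using occ_ge_1 sub by blast
      have "(\<Sum>D\<in>?H. clause_fail ?p (f D)) \<le> (\<Sum>D\<in>?H. 1 / (8 * real k) / real (occ F l))"
      proof (rule sum_mono)
        fix D assume D: "D \<in> ?H"
        then have "clause_fail ?p (f D) * real (occ F l) \<le> 1 / (8 * real k)"
          using f0(3) by (auto simp: f_def)
        then show "clause_fail ?p (f D) \<le> 1 / (8 * real k) / real (occ F l)"
          using o by (subst pos_le_divide_eq) auto
      qed
      also have "\<dots> = real (card ?H) * (1 / (8 * real k) / real (occ F l))" by simp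
      also have "\<dots> \<le> real (occ F l) * (1 / (8 * real k) / real (occ F l))"
        using card_mono[OF _ sub] cnf(2) by (intro mult_right_mono) (auto simp: occ_def)
      also have "\<dots> = 1 / (8 * real k)" using o by simp
      finally show ?thesis .
    qed
  qed
  have "satisfiable (f ` F)"
  proof (rule lopsided_local_lemma[of ?p])
    show "0 \<le> ?p x" "?p x \<le> 1" for x by (rule bias_bounds)+
    have cl: "is_clause (f D)" if "D \<in> F" for D
      using cnf(1) fsub[OF that] that finite_subset[OF fsub[OF that]] fin
      unfolding is_cnf_def is_clause_def by blast
    then show "is_cnf (f ` F)" using cnf by (auto simp: is_cnf_def)
    show "clause_fail ?p C < 1/2" if CF: "C \<in> f ` F" for C
    proof -
      obtain D where D: "D \<in> F" "C = f D" using CF by blast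
      have "clause_fail ?p C \<le> 1 / (8 * real k)"
      proof (cases "light D")
        case True
        have "clause_fail ?p D \<le> (\<Sum>D | D \<in> F \<and> light D. clause_fail ?p D)"
          using D True cnf(2) cf0 by (intro member_le_sum) auto
        then show ?thesis using light_sum D True by (simp add: f_def)
      next
        case False
        then obtain l where l: "l \<in> f0 D" using f0(2) D by blast
        have "1 \<le> real (occ F l)" using occ_ge_1[OF D(1), of l] f0(1) l D False by force
        then have "clause_fail ?p (f0 D) \<le> clause_fail ?p (f0 D) * real (occ F l)"
          using mult_left_mono[OF _ cf0, of 1 "real (occ F l)"] by simp
        then show ?thesis using f0(3)[OF D(1) False l] D False by (simp add: f_def)
      qed
      also have "\<dots> < 1/2" using k by (simp add: field_simps)
      finally show ?thesis .
    qed
    show "(\<Sum>D | D \<in> f ` F \<and> conflict C D. clause_fail ?p D) \<le> 1/4" if C: "C \<in> f ` F" for C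
    proof -
      have finC: "finite C" and cardC: "card C \<le> k"
        using C fsub fin card card_mono by (metis image_iff finite_subset, metis image_iff)
      let ?N = "\<lambda>l. {D\<in>F. compl_lit l \<in> f D}"
      have "(\<Sum>D | D \<in> f ` F \<and> conflict C D. clause_fail ?p D)
          = (\<Sum>D\<in>(\<lambda>(l, D). f D) ` Sigma C ?N. clause_fail ?p D)"
        by (rule sum.cong) (auto simp: conflict_iff image_iff)
      \<comment> \<open>Truncation may identify clauses, and a clause may conflict through several
        literals; both only enlarge the sum over pairs.\<close>
      also have "\<dots> \<le> (\<Sum>(l, D)\<in>Sigma C ?N. clause_fail ?p (f D))"
        using cnf(2) finC cf0 sum_image_le[of "Sigma C ?N" "clause_fail ?p" "\<lambda>(l, D). f D"]
        by (simp add: o_def case_prod_beta)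
      also have "\<dots> = (\<Sum>l\<in>C. \<Sum>D\<in>?N l. clause_fail ?p (f D))"
        using cnf(2) finC by (simp add: sum.Sigma)
      also have "\<dots> \<le> (\<Sum>l\<in>C. 1 / (4 * real k))"
      proof (rule sum_mono)
        fix l assume "l \<in> C"
        have "(\<Sum>D\<in>?N l. clause_fail ?p (f D))
          \<le> (\<Sum>D\<in>{D. D \<in> F \<and> light D} \<union> {D. D \<in> F \<and> \<not> light D \<and> compl_lit l \<in> f D}. clause_fail ?p (f D))"
          using cnf(2) cf0 by (intro sum_mono2) auto
        also have "\<dots> = (\<Sum>D | D \<in> F \<and> light D. clause_fail ?p (f D))
            + (\<Sum>D | D \<in> F \<and> \<not> light D \<and> compl_lit l \<in> f D. clause_fail ?p (f D))"
          using cnf(2) by (intro sum.union_disjoint) auto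
        also have "(\<Sum>D | D \<in> F \<and> light D. clause_fail ?p (f D)) = (\<Sum>D | D \<in> F \<and> light D. clause_fail ?p D)"
          by (rule sum.cong) (auto simp: f_def)
        also have "\<dots> + (\<Sum>D | D \<in> F \<and> \<not> light D \<and> compl_lit l \<in> f D. clause_fail ?p (f D))
            \<le> 1 / (8 * real k) + 1 / (8 * real k)"
          by (intro add_mono light_sum heavy_sum)
        also have "\<dots> = 1 / (4 * real k)" by (simp add: field_simps)
        finally show "(\<Sum>D\<in>?N l. clause_fail ?p (f D)) \<le> 1 / (4 * real k)" .
      qed
      also have "\<dots> = real (card C) * (1 / (4 * real k))" by simp
      also have "\<dots> \<le> real k * (1 / (4 * real k))"
        using cardC by (intro mult_right_mono) auto
      also have "\<dots> = 1/4" using k by simp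
      finally show ?thesis .
    qed
  qed
  then show ?thesis using satisfiable_truncation fsub by blast
qed

theorem num_conflicts_lower:
  "\<exists>c::real. c > 0 \<and> (\<forall>k\<ge>1. \<forall>F :: 'v cnf. is_k_cnf k F \<and> \<not> satisfiable F
     \<longrightarrow> real (num_conflicts F) \<ge> c * 2.69 ^ k)"
proof -
  \<comment> \<open>The cube of \<open>99998/100000\<close> times \<open>eta\<close> still exceeds
    \<open>2.69\<close>, which leaves room for \<open>k ^ 3\<close>.\<close>
  obtain B where B: "B > 0" "\<And>k. real k ^ 3 * ((99998/100000) ^ 3) ^ k \<le> B"
    using poly_times_power_bounded[of "99998/100000" 3] by auto
  show ?thesis
  proof (intro exI[of _ "1 / (128 * B)"] conjI allI impI)
    show "0 < 1 / (128 * B)" using B by simp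
    fix k :: nat and F :: "'v cnf"
    assume k: "1 \<le> k" and F: "is_k_cnf k F \<and> \<not> satisfiable F"
    have "eta ^ k < 128 * real k ^ 3 * real (num_conflicts F)"
      using few_conflicts_satisfiable[of k F] k F by force
    moreover have "real k ^ 3 * 2.69 ^ k \<le> B * eta ^ k"
    proof -
      have "(2.69 :: real) ^ k \<le> ((99998/100000) ^ 3 * eta) ^ k"
        by (intro power_mono) (simp_all add: eta_def power_divide)
      then have "real k ^ 3 * 2.69 ^ k \<le> real k ^ 3 * (((99998/100000) ^ 3) ^ k * eta ^ k)"
        unfolding power_mult_distrib by (intro mult_left_mono) auto
      also have "\<dots> \<le> B * eta ^ k"
        unfolding mult.assoc[symmetric] using B(2)[of k] by (intro mult_right_mono) (auto simp: eta_def)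
      finally show ?thesis .
    qed
    ultimately have "real k ^ 3 * 2.69 ^ k \<le> B * (128 * real k ^ 3 * real (num_conflicts F))"
      using B(1) by (smt (verit) mult_left_mono)
    then have "real k ^ 3 * 2.69 ^ k \<le> real k ^ 3 * (B * 128 * real (num_conflicts F))"
      by (simp add: mult_ac)
    then have "2.69 ^ k \<le> B * 128 * real (num_conflicts F)"
      using k by (subst (asm) mult_le_cancel_left_pos) auto
    then show "1 / (128 * B) * 2.69 ^ k \<le> real (num_conflicts F)"
      using B(1) by (simp add: field_simps)
  qed
qed

section \<open>The upper bound\<close>

lemma greedy_cover_step:
  fixes \<delta> :: real
  assumes "finite U" "finite A" "A \<noteq> {}"
    and hit: "\<And>b. b \<in> U \<Longrightarrow> \<delta> * card A \<le> card {c\<in>A. R c b}"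
  shows "\<exists>c\<in>A. \<delta> * card U \<le> card {b\<in>U. R c b}"
proof (rule ccontr)
  assume "\<not> ?thesis"
  then have lt: "real (card {b\<in>U. R c b}) < \<delta> * card U" if "c \<in> A" for c using that by force
  \<comment> \<open>Counting the incidences of \<open>R\<close> from both sides: if every
    \<open>c\<close> hit too little of \<open>U\<close>, the average would fall below
    \<open>\<delta>\<close>.\<close>
  have "card U * (\<delta> * card A) = (\<Sum>b\<in>U. \<delta> * card A)" by simp
  also have "\<dots> \<le> (\<Sum>b\<in>U. real (card {c\<in>A. R c b}))" by (intro sum_mono hit)
  also have "\<dots> = (\<Sum>b\<in>U. \<Sum>c\<in>A. if R c b then 1 else 0)"
    using assms(2) by (simp add: sum.If_cases Int_def conj_commute)
  also have "\<dots> = (\<Sum>c\<in>A. \<Sum>b\<in>U. if R c b then 1 else 0)" by (rule sum.swap)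
  also have "\<dots> = (\<Sum>c\<in>A. real (card {b\<in>U. R c b}))"
    using assms(1) by (simp add: sum.If_cases Int_def conj_commute)
  also have "\<dots> < (\<Sum>c\<in>A. \<delta> * card U)"
    using assms lt by (intro sum_strict_mono) auto
  also have "\<dots> = card U * (\<delta> * card A)" by simp
  finally show False by simp
qed

lemma card_Diff_add_card:
  assumes "finite X" "Y \<subseteq> X"
  shows "card (X - Y) + card Y = card X"
  using assms by (metis card_Diff_subset card_mono finite_subset le_add_diff_inverse2)

lemma greedy_cover:
  fixes \<delta> :: real
  assumes "finite B" "finite A" "A \<noteq> {}" "\<delta> \<le> 1"
    and hit: "\<And>b. b \<in> B \<Longrightarrow> \<delta> * card A \<le> card {c\<in>A. R c b}"
  shows "\<exists>D\<subseteq>A. card D \<le> m \<and> card {b\<in>B. \<forall>c\<in>D. \<not> R c b} \<le> (1 - \<delta>) ^ m * card B"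
proof (induction m)
  case 0
  then show ?case by (intro exI[of _ "{}"]) auto
next
  case (Suc m)
  then obtain D where D: "D \<subseteq> A" "card D \<le> m"
    "card {b\<in>B. \<forall>c\<in>D. \<not> R c b} \<le> (1 - \<delta>) ^ m * card B" by blast
  let ?U = "{b\<in>B. \<forall>c\<in>D. \<not> R c b}"
  obtain c where c: "c \<in> A" "\<delta> * card ?U \<le> card {b\<in>?U. R c b}"
    using greedy_cover_step[of ?U A \<delta> R] assms by auto
  have "finite ?U" using assms(1) by simp
  have eq: "{b\<in>B. \<forall>c\<in>insert c D. \<not> R c b} = ?U - {b\<in>?U. R c b}" by auto
  have cd: "card (?U - {b\<in>?U. R c b}) + card {b\<in>?U. R c b} = card ?U"
    by (rule card_Diff_add_card[OF \<open>finite ?U\<close>]) auto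
  have "real (card {b\<in>B. \<forall>c\<in>insert c D. \<not> R c b}) = real (card ?U) - card {b\<in>?U. R c b}"
    unfolding eq using arg_cong[OF cd, where f = real] unfolding of_nat_add by linarith
  also have "\<dots> \<le> (1 - \<delta>) * card ?U" using c(2) by (simp add: algebra_simps)
  also have "\<dots> \<le> (1 - \<delta>) * ((1 - \<delta>) ^ m * card B)"
    using assms(4) D(3) by (intro mult_left_mono) auto
  finally have "real (card {b\<in>B. \<forall>c\<in>insert c D. \<not> R c b}) \<le> (1 - \<delta>) ^ Suc m * card B" by simp
  moreover have "card (insert c D) \<le> Suc m"
    using D(2) card_insert_le_m1[of "Suc m" D c] by simp
  ultimately show ?case using D(1) c(1) by (intro exI[of _ "insert c D"]) auto
qed

lemma small_cover_exists:
  fixes \<delta> :: real and n :: nat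
  assumes "finite B" "card B \<le> 2 ^ n" "n > 0" "finite A" "A \<noteq> {}" "0 < \<delta>" "\<delta> \<le> 1"
    and hit: "\<And>b. b \<in> B \<Longrightarrow> \<delta> * card A \<le> card {c\<in>A. R c b}"
  shows "\<exists>D\<subseteq>A. card D \<le> 3 * n / \<delta> \<and> (\<forall>b\<in>B. \<exists>c\<in>D. R c b)"
proof -
  \<comment> \<open>After \<open>2 * n / \<delta>\<close> rounds at most
    \<open>exp (- 2 n) * 2 ^ n < 1\<close> elements remain, hence none. Rounding up costs at most 1,
    which is below the extra \<open>n / \<delta>\<close> in the bound.\<close>
  define m where "m = nat \<lceil>2 * n / \<delta>\<rceil>"
  have m: "2 * n / \<delta> \<le> m" "m \<le> 2 * n / \<delta> + 1"
    using assms(6) by (auto simp: m_def)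
  have "\<exists>D\<subseteq>A. card D \<le> m \<and> card {b\<in>B. \<forall>c\<in>D. \<not> R c b} \<le> (1 - \<delta>) ^ m * card B"
    by (rule greedy_cover[OF assms(1,4,5,7) hit])
  then obtain D where D: "D \<subseteq> A" "card D \<le> m"
    "card {b\<in>B. \<forall>c\<in>D. \<not> R c b} \<le> (1 - \<delta>) ^ m * card B"
    by (elim exE conjE) (rule that)
  have "(1 - \<delta>) ^ m \<le> exp (- \<delta>) ^ m"
    using assms(7) exp_ge_add_one_self[of "- \<delta>"] by (intro power_mono) auto
  also have "\<dots> = exp (- (\<delta> * m))" by (simp add: exp_of_nat_mult[symmetric] mult.commute)
  also have "\<dots> \<le> exp (- (2 * n))" using m(1) assms(6) by (simp add: field_simps)
  also have "\<dots> = 1 / (exp 1 ^ n * exp 1 ^ n)"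
    by (simp add: exp_minus exp_of_nat_mult[symmetric] exp_add[symmetric] divide_inverse)
  also have "\<dots> \<le> 1 / (2 ^ n * 2 ^ n)"
    using exp_ge_add_one_self[of 1] by (intro divide_left_mono mult_mono power_mono) auto
  finally have "(1 - \<delta>) ^ m * card B \<le> 1 / (2 ^ n * 2 ^ n) * 2 ^ n"
    using assms(2) by (intro mult_mono) (auto simp flip: of_nat_power_le_of_nat_cancel_iff)
  also have "\<dots> = 1 / 2 ^ n" by simp
  also have "\<dots> < 1" using assms(3) by simp
  finally have "card {b\<in>B. \<forall>c\<in>D. \<not> R c b} = 0" using D(3) by linarith
  then have "\<forall>b\<in>B. \<exists>c\<in>D. R c b" using assms(1) by auto
  moreover have "card D \<le> 3 * n / \<delta>"
  proof -
    have "1 \<le> n / \<delta>" using assms(3,6,7) by (simp add: pos_le_divide_eq)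
    then have "m \<le> 2 * (n / \<delta>) + n / \<delta>" using m(2) by simp
    also have "\<dots> = 3 * n / \<delta>" by simp
    finally show ?thesis using D(2) by linarith
  qed
  ultimately show ?thesis using D(1) by blast
qed

section \<open>Covers by subsets of fixed size\<close>

lemma binomial_ratio_ge:
  fixes c :: real and a n r :: nat
  assumes "r \<le> a" "0 \<le> c" "c * n \<le> real a - r"
  shows "c ^ r * (n choose r) \<le> (a choose r)"
proof -
  \<comment> \<open>After multiplying by \<open>fact r\<close>, one falling factorial is at most
    \<open>n ^ r\<close> and the other at least \<open>(a - r) ^ r\<close>.\<close>
  have "c ^ r * (n choose r) * fact r = c ^ r * real ((n choose r) * fact r)" by simp
  also have "\<dots> \<le> c ^ r * real (n ^ r)"
    using binomial_fact_pow[of n r] assms(2) by (intro mult_left_mono of_nat_mono) auto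
  also have "\<dots> = (c * n) ^ r" by (simp add: power_mult_distrib)
  also have "\<dots> \<le> (real a - r) ^ r" using assms by (intro power_mono) auto
  also have "\<dots> = (\<Prod>i=0..<r. real a - r)" by simp
  also have "\<dots> \<le> (\<Prod>i=0..<r. real a - i)" using assms(1) by (intro prod_mono) auto
  also have "\<dots> = fact r * (real a gchoose r)" by (simp add: gbinomial_mult_fact)
  also have "\<dots> = (a choose r) * fact r" by (simp add: binomial_gbinomial)
  finally show ?thesis by simp
qed

text \<open>Greedy covering with \<open>\<delta> = c ^ r\<close>: a set of size at least
  \<open>a\<close> contains at least that fraction of all \<open>r\<close>-subsets.\<close>

lemma subset_cover_exists:
  fixes c :: real and a n r :: nat
  assumes "n > 0" "r \<le> a" "a \<le> n" "0 < c" "c * n \<le> real a - r"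
  shows "\<exists>\<K>. finite \<K> \<and> card \<K> \<le> 3 * n / c ^ r \<and> (\<forall>K\<in>\<K>. finite K \<and> card K = r)
    \<and> (\<forall>S. S \<subseteq> {..<n} \<and> a \<le> card S \<longrightarrow> (\<exists>K\<in>\<K>. K \<subseteq> S))"
proof -
  let ?A = "{K. K \<subseteq> {..<n} \<and> card K = r}"
  let ?B = "{S. S \<subseteq> {..<n} \<and> a \<le> card S}"
  have cardA: "card ?A = n choose r" by (simp add: n_subsets)
  have finA: "finite ?A" by (rule finite_subset[of _ "Pow {..<n}"]) auto
  have c1: "c \<le> 1"
  proof -
    have "c * n \<le> 1 * real n" using assms(3,5) by linarith
    then show ?thesis by (rule mult_right_le_imp_le) (use assms(1) in simp)
  qed
  have "\<exists>\<K>\<subseteq>?A. card \<K> \<le> 3 * n / c ^ r \<and> (\<forall>S\<in>?B. \<exists>K\<in>\<K>. K \<subseteq> S)"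
  proof (rule small_cover_exists)
    show "finite ?B" by (rule finite_subset[of _ "Pow {..<n}"]) auto
    have "card ?B \<le> card (Pow {..<n})" by (rule card_mono) auto
    then show "card ?B \<le> 2 ^ n" by (simp add: card_Pow)
    show "?A \<noteq> {}" using cardA assms(2,3) finA by (metis binomial_eq_0_iff card.empty le_trans not_le)
    show "0 < c ^ r" "c ^ r \<le> 1" using assms(4) c1 by (auto intro: power_le_one)
    fix S assume S: "S \<in> ?B"
    then have finS: "finite S" by (auto intro: finite_subset)
    have "{K\<in>?A. K \<subseteq> S} = {K. K \<subseteq> S \<and> card K = r}" using S by auto
    then have "card {K\<in>?A. K \<subseteq> S} = card S choose r" using finS by (simp add: n_subsets)
    moreover have "c ^ r * (n choose r) \<le> (card S choose r)"
      using S assms by (intro binomial_ratio_ge) auto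
    ultimately show "c ^ r * card ?A \<le> card {K\<in>?A. K \<subseteq> S}" using cardA by simp
  qed (use assms(1) finA in auto)
  then obtain \<K> where "\<K> \<subseteq> ?A" "card \<K> \<le> 3 * n / c ^ r" "\<forall>S\<in>?B. \<exists>K\<in>\<K>. K \<subseteq> S" by blast
  moreover from this have "finite \<K>" "\<forall>K\<in>\<K>. finite K \<and> card K = r"
    using finA by (auto intro: finite_subset)
  ultimately show ?thesis by (intro exI[of _ \<K>]) auto
qed

section \<open>The unsatisfiable formula\<close>

definition base_var :: "nat \<Rightarrow> nat" where
  "base_var i = prod_encode (0, i)"

text \<open>Each finite \<open>K\<close> gets its own block of fresh variables, since
  \<open>set_encode\<close> is injective on finite sets; \<open>Suc\<close> keeps the blocks apart
  from tag 0 of \<open>base_var\<close>.\<close>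

definition aux_var :: "nat set \<Rightarrow> nat \<Rightarrow> nat" where
  "aux_var K t = prod_encode (Suc (set_encode K), t)"

definition pos_clause :: "nat set \<Rightarrow> nat clause" where
  "pos_clause K = (\<lambda>i. Pos (base_var i)) ` K"

definition neg_clause :: "nat \<Rightarrow> nat set \<Rightarrow> nat set \<Rightarrow> nat clause" where
  "neg_clause r K J = (\<lambda>i. Neg (base_var i)) ` K
     \<union> (\<lambda>t. if t \<in> J then Pos (aux_var K t) else Neg (aux_var K t)) ` {..<r}"

lemma var_simps [simp]:
  "base_var i = base_var j \<longleftrightarrow> i = j"
  "base_var i \<noteq> aux_var K t" "aux_var K t \<noteq> base_var i"
  "aux_var K s = aux_var K t \<longleftrightarrow> s = t"
  by (auto simp: base_var_def aux_var_def)

lemma aux_var_eqD: "aux_var K s = aux_var L t \<Longrightarrow> finite K \<Longrightarrow> finite L \<Longrightarrow> K = L \<and> s = t"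
  by (auto simp: aux_var_def set_encode_eq)

lemma pos_clause_lits:
  "Pos x \<in> pos_clause K \<longleftrightarrow> (\<exists>i\<in>K. x = base_var i)" "Neg x \<notin> pos_clause K"
  by (auto simp: pos_clause_def)

lemma neg_clause_lits:
  "Pos x \<in> neg_clause r K J \<longleftrightarrow> (\<exists>t<r. t \<in> J \<and> x = aux_var K t)"
  "Neg x \<in> neg_clause r K J \<longleftrightarrow> (\<exists>i\<in>K. x = base_var i) \<or> (\<exists>t<r. t \<notin> J \<and> x = aux_var K t)"
  by (auto simp: neg_clause_def image_iff)

lemma card_pos_clause: "card (pos_clause K) = card K"
  unfolding pos_clause_def by (rule card_image) (auto simp: inj_on_def)

lemma card_neg_clause:
  assumes "finite K"
  shows "card (neg_clause r K J) = card K + r"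
proof -
  have "card (neg_clause r K J) = card ((\<lambda>i. Neg (base_var i)) ` K)
     + card ((\<lambda>t. if t \<in> J then Pos (aux_var K t) else Neg (aux_var K t)) ` {..<r})"
    unfolding neg_clause_def using assms by (intro card_Un_disjoint) (auto split: if_splits)
  also have "card ((\<lambda>i. Neg (base_var i)) ` K) = card K"
    by (rule card_image) (auto simp: inj_on_def)
  also have "card ((\<lambda>t. if t \<in> J then Pos (aux_var K t) else Neg (aux_var K t)) ` {..<r}) = r"
    by (subst card_image) (auto simp: inj_on_def split: if_splits)
  finally show ?thesis .
qed

text \<open>Negative clauses conflict only within one block, so they give a term linear in
  \<open>card \<Q>\<close>; for mixed pairs all combinations are counted.\<close>

lemma two_sided_cover_formula:
  fixes \<P> \<Q> :: "nat set set"
  assumes P: "finite \<P>" "\<And>K. K \<in> \<P> \<Longrightarrow> finite K \<and> card K = k"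
    and Q: "finite \<Q>" "\<And>K. K \<in> \<Q> \<Longrightarrow> finite K \<and> card K = l" and "l \<le> k"
    and cover: "\<And>S. (\<exists>K\<in>\<P>. K \<inter> S = {}) \<or> (\<exists>K\<in>\<Q>. K \<subseteq> S)"
  shows "\<exists>F :: nat cnf. is_k_cnf k F \<and> \<not> satisfiable F
    \<and> num_conflicts F \<le> card \<P> * (card \<Q> * 2 ^ (k - l)) + card \<Q> * 4 ^ (k - l)"
proof -
  define r where "r = k - l"
  define J where "J = Pow {..<r}"
  have J: "finite J" "card J = 2 ^ r" by (auto simp: J_def card_Pow)
  define F where "F = pos_clause ` \<P> \<union> (\<lambda>(K, I). neg_clause r K I) ` (\<Q> \<times> J)"
  have "is_k_cnf k F"
  proof -
    have "is_clause C \<and> card C = k" if "C \<in> F" for C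
    proof -
      from that consider K where "K \<in> \<P>" "C = pos_clause K"
        | K I where "K \<in> \<Q>" "C = neg_clause r K I" by (auto simp: F_def)
      then show ?thesis
      proof cases
        case 1
        then show ?thesis using P(2)[of K]
          by (auto simp: is_clause_def pos_clause_lits card_pos_clause) (simp add: pos_clause_def)
      next
        case 2
        then show ?thesis using Q(2)[of K] assms(5)
          by (auto simp: is_clause_def neg_clause_lits card_neg_clause r_def) (simp add: neg_clause_def)
      qed
    qed
    moreover have "finite F" using P(1) Q(1) J(1) by (simp add: F_def)
    ultimately show ?thesis by (auto simp: is_k_cnf_def is_cnf_def)
  qed
  moreover have "\<not> satisfiable F"
  proof
    assume "satisfiable F"
    then obtain \<alpha> where \<alpha>: "\<And>C. C \<in> F \<Longrightarrow> \<exists>m\<in>C. lit_true \<alpha> m"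
      by (auto simp: satisfiable_def satisfies_def)
    from cover[of "{i. \<alpha> (base_var i)}"] show False
    proof
      assume "\<exists>K\<in>\<P>. K \<inter> {i. \<alpha> (base_var i)} = {}"
      then obtain K where K: "K \<in> \<P>" "K \<inter> {i. \<alpha> (base_var i)} = {}" by blast
      then have "\<exists>m\<in>pos_clause K. lit_true \<alpha> m" by (intro \<alpha>) (simp add: F_def)
      then show False using K(2) by (auto simp: pos_clause_def)
    next
      assume "\<exists>K\<in>\<Q>. K \<subseteq> {i. \<alpha> (base_var i)}"
      then obtain K where K: "K \<in> \<Q>" "K \<subseteq> {i. \<alpha> (base_var i)}" by blast
      \<comment> \<open>The sign pattern all of whose auxiliary literals are false under
        \<open>\<alpha>\<close>.\<close>
      define I where "I = {t. t < r \<and> \<not> \<alpha> (aux_var K t)}"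
      have "I \<in> J" by (auto simp: I_def J_def)
      then have "\<exists>m\<in>neg_clause r K I. lit_true \<alpha> m"
        using K(1) by (intro \<alpha>) (auto simp: F_def)
      then show False using K(2) by (auto simp: neg_clause_def I_def split: if_splits)
    qed
  qed
  moreover have "num_conflicts F \<le> card \<P> * (card \<Q> * 2 ^ r) + card \<Q> * 4 ^ r"
  proof -
    let ?e1 = "\<lambda>(K, L, I). {pos_clause K, neg_clause r L I}"
    let ?e2 = "\<lambda>(K, I, I'). {neg_clause r K I, neg_clause r K I'}"
    have "conflict_edges F \<subseteq> ?e1 ` (\<P> \<times> \<Q> \<times> J) \<union> ?e2 ` (\<Q> \<times> J \<times> J)"
    proof
      fix e assume "e \<in> conflict_edges F"
      then obtain C D where e: "e = {C, D}" "C \<in> F" "D \<in> F" "conflict C D"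
        by (auto simp: conflict_edges_def)
      have pp: "\<not> conflict (pos_clause K) (pos_clause L)" for K L
        by (auto simp: conflict_def pos_clause_lits)
      have nn: "K = L" if "conflict (neg_clause r K I) (neg_clause r L I')" "K \<in> \<Q>" "L \<in> \<Q>" for K L I I'
        using that Q(2) by (auto simp: conflict_def neg_clause_lits dest!: aux_var_eqD)
      have "C \<in> pos_clause ` \<P> \<or> (\<exists>K\<in>\<Q>. \<exists>I\<in>J. C = neg_clause r K I)"
        "D \<in> pos_clause ` \<P> \<or> (\<exists>K\<in>\<Q>. \<exists>I\<in>J. D = neg_clause r K I)"
        using e(2,3) by (auto simp: F_def)
      then consider (pp) K L where "C = pos_clause K" "D = pos_clause L"
        | (pn) K L I where "K \<in> \<P>" "L \<in> \<Q>" "I \<in> J" "e = {pos_clause K, neg_clause r L I}"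
        | (nn) K L I I' where "K \<in> \<Q>" "L \<in> \<Q>" "I \<in> J" "I' \<in> J" "C = neg_clause r K I" "D = neg_clause r L I'"
        using e(1) by (auto simp: insert_commute)
      then show "e \<in> ?e1 ` (\<P> \<times> \<Q> \<times> J) \<union> ?e2 ` (\<Q> \<times> J \<times> J)"
      proof cases
        case pp
        then show ?thesis using \<open>conflict C D\<close> \<open>\<And>K L. \<not> conflict (pos_clause K) (pos_clause L)\<close> by simp
      next
        case pn
        then show ?thesis by (intro UnI1 image_eqI[of _ _ "(K, L, I)"]) auto
      next
        case (nn K L I I')
        then have "K = L" using \<open>conflict C D\<close> \<open>\<And>K L I I'. conflict (neg_clause r K I) (neg_clause r L I') \<Longrightarrow> K \<in> \<Q> \<Longrightarrow> L \<in> \<Q> \<Longrightarrow> K = L\<close> by simp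
        then show ?thesis using nn e(1) by (intro UnI2 image_eqI[of _ _ "(K, I, I')"]) auto
      qed
    qed
    then have "card (conflict_edges F) \<le> card (?e1 ` (\<P> \<times> \<Q> \<times> J) \<union> ?e2 ` (\<Q> \<times> J \<times> J))"
      using P(1) Q(1) J(1) by (intro card_mono) auto
    also have "\<dots> \<le> card (?e1 ` (\<P> \<times> \<Q> \<times> J)) + card (?e2 ` (\<Q> \<times> J \<times> J))" by (rule card_Un_le)
    also have "\<dots> \<le> card (\<P> \<times> \<Q> \<times> J) + card (\<Q> \<times> J \<times> J)"
      using P(1) Q(1) J(1) by (intro add_mono card_image_le) auto
    also have "\<dots> = card \<P> * (card \<Q> * 2 ^ r) + card \<Q> * (2 ^ r * 2 ^ r)"
      using J(2) by (simp add: card_cartesian_product)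
    also have "(2::nat) ^ r * 2 ^ r = 4 ^ r" by (simp flip: power_mult_distrib)
    finally show ?thesis by (simp add: num_conflicts_def)
  qed
  ultimately show ?thesis unfolding r_def by blast
qed

text \<open>The exponential rates of the two kinds of conflicts, \<open>(2 / (1 - p)) * (2 p) powr (- \<lambda>)\<close> and
  \<open>4 * (4 p) powr (- \<lambda>)\<close> for negative parts of size \<open>\<lambda> k\<close> and threshold density \<open>p\<close>, balance at
  \<open>\<lambda> = 1/3\<close> and \<open>p = 1 - 2 powr (- 2/3) = 0.37003\<dots>\<close>, near the optimum.\<close>

lemma sparse_unsat_formula:
  assumes "k \<ge> 1"
  shows "\<exists>F :: nat cnf. is_k_cnf k F \<and> \<not> satisfiable F
    \<and> real (num_conflicts F) \<le> 288 * 10 ^ 12 * real k ^ 2 * (4324/100) ^ (k div 3)"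
proof -
  define l where "l = k div 3"
  \<comment> \<open>This size makes the thresholds \<open>629970 * k\<close> and
    \<open>370030 * k\<close> integers with sum \<open>n\<close>. Subtracting the clause size, at
    most \<open>k\<close>, lowers the densities by at most one millionth, to \<open>c1\<close> and
    \<open>c2\<close>.\<close>
  define n where "n = 1000000 * k"
  define c1 c2 :: real where "c1 = 629969/1000000" and "c2 = 370029/1000000"
  have lk: "l \<le> k" by (simp add: l_def)
  obtain \<P> where P: "finite \<P>" "card \<P> \<le> 3 * n / c1 ^ k" "\<And>K. K \<in> \<P> \<Longrightarrow> finite K \<and> card K = k"
    "\<And>S. S \<subseteq> {..<n} \<Longrightarrow> 629970 * k \<le> card S \<Longrightarrow> \<exists>K\<in>\<P>. K \<subseteq> S"
    using subset_cover_exists[of n k "629970 * k" c1] assms by (auto simp: n_def c1_def)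
  obtain \<Q> where Q: "finite \<Q>" "card \<Q> \<le> 3 * n / c2 ^ l" "\<And>K. K \<in> \<Q> \<Longrightarrow> finite K \<and> card K = l"
    "\<And>S. S \<subseteq> {..<n} \<Longrightarrow> 370030 * k \<le> card S \<Longrightarrow> \<exists>K\<in>\<Q>. K \<subseteq> S"
    using subset_cover_exists[of n l "370030 * k" c2] assms lk by (auto simp: n_def c2_def)
  have "(\<exists>K\<in>\<P>. K \<inter> S = {}) \<or> (\<exists>K\<in>\<Q>. K \<subseteq> S)" for S
  proof (cases "370030 * k \<le> card (S \<inter> {..<n})")
    case True
    then show ?thesis using Q(4)[of "S \<inter> {..<n}"] by blast
  next
    case False
    have "card ({..<n} - S \<inter> {..<n}) = n - card (S \<inter> {..<n})" by (subst card_Diff_subset) auto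
    then have "629970 * k \<le> card ({..<n} - S \<inter> {..<n})" using False by (simp add: n_def)
    then show ?thesis using P(4)[of "{..<n} - S \<inter> {..<n}"] by blast
  qed
  from two_sided_cover_formula[OF P(1,3) Q(1,3) lk this]
  obtain F :: "nat cnf" where F: "is_k_cnf k F" "\<not> satisfiable F"
    "num_conflicts F \<le> card \<P> * (card \<Q> * 2 ^ (k - l)) + card \<Q> * 4 ^ (k - l)" by blast
  \<comment> \<open>Rounding \<open>k / 3\<close> down leaves \<open>r \<le> 2\<close>, which costs
    only the constant 16. Per unit of \<open>l\<close> both kinds of conflicts then grow by less
    than \<open>4324/100\<close>.\<close>
  define r where "r = k mod 3"
  have "k = 3 * l + r" by (simp add: l_def r_def)
  then have k: "k = 3 * l + r" "k - l = 2 * l + r" "r \<le> 2" by (auto simp: r_def)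
  have r4: "(4::real) ^ r \<le> 16" using power_increasing[OF k(3), of "4::real"] by simp
  have n1: "1 \<le> real n" using assms by (simp add: n_def)
  have c: "c1 > 0" "c2 > 0" by (auto simp: c1_def c2_def)
  have "real n * 1 \<le> real n * real n" using n1 by (intro mult_left_mono) auto
  then have n2: "3 * real n \<le> 9 * real n ^ 2" by (simp add: power2_eq_square)
  have e1: "2 ^ (k - l) / (c1 ^ k * c2 ^ l) \<le> 16 * (4324/100) ^ l"
  proof -
    have "2 ^ (k - l) / (c1 ^ k * c2 ^ l) = (2 / c1) ^ r * (4 / (c1 ^ 3 * c2)) ^ l"
      unfolding k(1) k(2)[unfolded k(1)]
      by (simp add: power_add power_mult power_divide power_mult_distrib) (simp add: mult_ac)
    also have "\<dots> \<le> 4 ^ r * (4324/100) ^ l"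
      by (intro mult_mono power_mono) (auto simp: c1_def c2_def power_divide)
    also have "\<dots> \<le> 16 * (4324/100) ^ l" using r4 by (intro mult_right_mono) auto
    finally show ?thesis .
  qed
  have e2: "4 ^ (k - l) / c2 ^ l \<le> 16 * (4324/100) ^ l"
  proof -
    have "4 ^ (k - l) / c2 ^ l = 4 ^ r * (16 / c2) ^ l"
      unfolding k(2) by (simp add: power_add power_mult power_divide)
    also have "\<dots> \<le> 16 * (4324/100) ^ l"
      using r4 by (intro mult_mono power_mono) (auto simp: c2_def)
    finally show ?thesis .
  qed
  have "real (num_conflicts F) \<le> real (card \<P> * (card \<Q> * 2 ^ (k - l)) + card \<Q> * 4 ^ (k - l))"
    using F(3) by (rule of_nat_mono)
  also have "\<dots> = real (card \<P>) * (real (card \<Q>) * 2 ^ (k - l)) + real (card \<Q>) * 4 ^ (k - l)"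
    by simp
  also have "\<dots> \<le> (3 * n / c1 ^ k) * ((3 * n / c2 ^ l) * 2 ^ (k - l)) + (3 * n / c2 ^ l) * 4 ^ (k - l)"
    by (intro add_mono mult_mono[OF P(2)] mult_right_mono[OF Q(2)]) (use c in auto)
  also have "\<dots> = 9 * real n ^ 2 * (2 ^ (k - l) / (c1 ^ k * c2 ^ l)) + 3 * real n * (4 ^ (k - l) / c2 ^ l)"
    by (simp add: power2_eq_square)
  also have "\<dots> \<le> 9 * real n ^ 2 * (16 * (4324/100) ^ l) + 9 * real n ^ 2 * (16 * (4324/100) ^ l)"
    by (intro add_mono mult_left_mono e1 mult_mono[OF n2 e2]) (use c in auto)
  also have "\<dots> = 288 * 10 ^ 12 * real k ^ 2 * (4324/100) ^ l"
    by (simp add: n_def power_mult_distrib)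
  finally show ?thesis using F(1,2) unfolding l_def by blast
qed

theorem num_conflicts_upper:
  "\<exists>C::real. C > 0 \<and> (\<forall>k\<ge>1. \<exists>F :: nat cnf. is_k_cnf k F \<and> \<not> satisfiable F
     \<and> real (num_conflicts F) \<le> C * 3.51 ^ k)"
proof -
  \<comment> \<open>Chosen so that \<open>?y ^ 2 * 3.51 ^ 3\<close> still exceeds
    \<open>4324/100\<close>.\<close>
  let ?y = "99996/100000 :: real"
  obtain B where B: "B > 0" "\<And>n. real n ^ 2 * (?y ^ 2) ^ n \<le> B"
    using poly_times_power_bounded[of ?y 2] by auto
  have bound: "real k ^ 2 * (4324/100) ^ (k div 3) \<le> 18 * B * 3.51 ^ k" for k
  proof -
    define l where "l = k div 3"
    have l: "3 * l \<le> k" "real k \<le> 3 * real (Suc l)" by (auto simp: l_def)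
    have "real k ^ 2 * (4324/100) ^ l \<le> (3 * real (Suc l)) ^ 2 * (?y ^ 2 * 3.51 ^ 3) ^ l"
      using l(2) by (intro mult_mono power_mono) (auto simp: power_divide)
    \<comment> \<open>One factor \<open>?y ^ 2\<close> is borrowed so that the exponent matches
      \<open>Suc l\<close>, as needed to apply the bound \<open>B\<close>.\<close>
    also have "\<dots> = 9 / ?y ^ 2 * (real (Suc l) ^ 2 * (?y ^ 2) ^ Suc l) * 3.51 ^ (3 * l)"
      by (simp add: power_mult_distrib power_mult del: of_nat_Suc)
    also have "\<dots> \<le> 18 * B * 3.51 ^ k"
    proof (intro mult_mono power_increasing l(1) B(2))
      show "9 / ?y ^ 2 \<le> 18" by (simp add: power_divide)
    qed (use B(1) in auto)
    finally show ?thesis by (simp add: l_def)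
  qed
  show ?thesis
  proof (intro exI[of _ "288 * 10 ^ 12 * (18 * B)"] conjI allI impI)
    show "0 < 288 * 10 ^ 12 * (18 * B)" using B(1) by simp
    fix k :: nat assume "1 \<le> k"
    from sparse_unsat_formula[OF this] obtain F :: "nat cnf" where
      F: "is_k_cnf k F" "\<not> satisfiable F"
      "real (num_conflicts F) \<le> 288 * 10 ^ 12 * real k ^ 2 * (4324/100) ^ (k div 3)" by blast
    have "288 * 10 ^ 12 * (real k ^ 2 * (4324/100) ^ (k div 3)) \<le> 288 * 10 ^ 12 * (18 * B * 3.51 ^ k)"
      by (intro mult_left_mono bound) auto
    then show "\<exists>F :: nat cnf. is_k_cnf k F \<and> \<not> satisfiable F
        \<and> real (num_conflicts F) \<le> 288 * 10 ^ 12 * (18 * B) * 3.51 ^ k"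
      using F by (intro exI[of _ F]) (auto simp: mult.assoc)
  qed
qed

theorem theorem1:
  shows "(\<exists>c::real. c > 0 \<and>
            (\<forall>k::nat. k \<ge> 1 \<longrightarrow>
              (\<forall>F :: nat cnf. is_k_cnf k F \<and> \<not> satisfiable F \<longrightarrow>
                 real (num_conflicts F) \<ge> c * 2.69 ^ k)))
       \<and> (\<exists>C::real. C > 0 \<and>
            (\<forall>k::nat. k \<ge> 1 \<longrightarrow>
              (\<exists>F :: nat cnf. is_k_cnf k F \<and> \<not> satisfiable F \<and>
                 real (num_conflicts F) \<le> C * 3.51 ^ k)))"
  using num_conflicts_lower[where 'v = nat] num_conflicts_upper by blast

end
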